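(* Let $Y\in\mathbb{R}$, $Z\in\mathbb{R}^p$, $X=(X^{(1)},\dots,X^{(d)})\in\mathbb{R}^d$ and $W\in\mathbb{R}^d$ be random variables/vectors with finite second moments, with $$\mathrm{Cov}\begin{pmatrix} Z\\ X\\ W\end{pmatrix}=\begin{bmatrix} A & B & C\\ B^{\mathsf T} & D & F\\ C^{\mathsf T} & F^{\mathsf T} & G\end{bmatrix},\quad A\in\mathbb{R}^{p\times p},\ B,C\in\mathbb{R}^{p\times d},\ D,F,G\in\mathbb{R}^{d\times d}.$$ Let $(\alpha,\beta_Z,\beta_X)=\arg\min_{a,b_Z,b_X}\mathbb{E}\big[\tfrac12(Y-a-Z^{\mathsf T}b_Z-X^{\mathsf T}b_X)^2\big]$ and $\beta=(\beta_Z,\beta_X)$. Let $(Y_i,Z_i,X_i,W_i)_{i=1}^N$ be samples satisfying: (i) the samples are identically distributed with the law of $(Y,Z,X,W)$, and the sample first and second moments converge in probability to the corresponding population moments as $N\to\infty$; (ii) with $\varepsilon_i=Y_i-\alpha-Z_i^{\mathsf T}\beta_Z-X_i^{\mathsf T}\beta_X$, $\varepsilon_i$ is uncorrelated with $W_i-X_i$; (iii) the covariance matrices of $(Z,W)$ and of $(Z,X)$ are positive definite. Let $\hat\beta^{(\mathrm{ME})}=(\hat\beta_Z^{(\mathrm{ME})},\hat\beta_X^{(\mathrm{ME})})$ be the OLS coefficients of $(Z_i,W_i)$ in the regression of $Y_i$ on an intercept, $Z_i$ and $W_i$, and let $\mathrm{bias}^{(\mathrm{ME})}_{\beta_X}=\operatorname{plim}_{N\to\infty}\big(\hat\beta_X^{(\mathrm{ME})}-\beta_X\big)$.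 Suppose the entries of $X$ are exactly the pollutant concentrations (no entry of $Z$ is a pollutant), and assume: (Pairwise Partial $\mathrm{PC}_+$) for every $j\ne j'$ in $\{1,\dots,d\}$, the partial correlation of $X^{(j)}$ and $X^{(j')}$ conditional on all remaining entries of $(Z,X)$ is positive; (CUME) $W=X+E$ with $E$ independent of $(Z,X,Y)$ and $\Sigma_E:=\mathrm{Cov}(E)=\mathrm{diag}(a_1,\dots,a_d)$ with $a_j\ge 0$. Then $$\mathrm{bias}^{(\mathrm{ME})}_{\beta_X}=-\Omega\,\Sigma_E\,\beta_X,\qquad \Omega:=\big(\Sigma_E+D-C^{\mathsf T}A^{-1}C\big)^{-1},$$ and for all $j,j'\in\{1,\dots,d\}$: $\Omega_{jj}\in(0,1/a_j]$ (with $1/a_j=\infty$ when $a_j=0$), and $\Omega_{jj'}\le 0$ if $j\ne j'$.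
   Context: Partial correlation of two entries of a random vector given other entries is the correlation of their population linear-regression residuals on those other entries. "plim" denotes limit in probability. *)

theory Defs
  imports "HOL-Probability.Probability"
begin

section \<open>Convergence in probability (to a constant), via outer probability\<close>

text \<open>The random elements converge in probability to the constant c:
  for every eps>0 the event {dist (Xn n) c > eps} is, eventually, contained in
  a measurable event of arbitrarily small probability. (For measurable Xn this is
  the usual definition: prob {dist (Xn n) c > eps} tends to 0.)\<close>
definition conv_in_prob ::
  "'a measure \<Rightarrow> (nat \<Rightarrow> 'a \<Rightarrow> 'b::metric_space) \<Rightarrow> 'b \<Rightarrow> bool" where
  "conv_in_prob M Xn c \<longleftrightarrow>
     (\<forall>e>0. \<forall>\<delta>>0. eventually (\<lambda>n. \<exists>A\<in>sets M.
        {\<omega>\<in>space M. dist (Xn n \<omega>) c > e} \<subseteq> A \<and> measure M A < \<delta>) sequentially)"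

section \<open>Covariances\<close>

definition cov :: "'a measure \<Rightarrow> ('a \<Rightarrow> real) \<Rightarrow> ('a \<Rightarrow> real) \<Rightarrow> real" where
  "cov M U V = (\<integral>\<omega>. U \<omega> * V \<omega> \<partial>M) - (\<integral>\<omega>. U \<omega> \<partial>M) * (\<integral>\<omega>. V \<omega> \<partial>M)"

definition corr :: "'a measure \<Rightarrow> ('a \<Rightarrow> real) \<Rightarrow> ('a \<Rightarrow> real) \<Rightarrow> real" where
  "corr M U V = cov M U V / sqrt (cov M U U * cov M V V)"

text \<open>Cross-covariance matrix Cov(U,V) = E[U V^T] - E[U] E[V]^T.\<close>
definition covmat ::
  "'a measure \<Rightarrow> ('a \<Rightarrow> real^'m) \<Rightarrow> ('a \<Rightarrow> real^'n) \<Rightarrow> real^'n^'m" where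
  "covmat M U V = (\<chi> i j. cov M (\<lambda>\<omega>. U \<omega> $ i) (\<lambda>\<omega>. V \<omega> $ j))"

text \<open>Stacking two random vectors (U,V) into one vector indexed by 'm + 'n.\<close>
definition stack :: "real^'m \<Rightarrow> real^'n \<Rightarrow> real^('m + 'n)" where
  "stack u v = (\<chi> k. case k of Inl i \<Rightarrow> u $ i | Inr j \<Rightarrow> v $ j)"

definition pos_def_mat :: "real^'n^'n \<Rightarrow> bool" where
  "pos_def_mat S \<longleftrightarrow> transpose S = S \<and> (\<forall>u. u \<noteq> 0 \<longrightarrow> u \<bullet> (S *v u) > 0)"

section \<open>Population linear regression residuals and partial correlation\<close>

text \<open>Residual of the population linear regression (with intercept) of U on the
  entries V$k, k \<in> S, of the random vector V.\<close>
definition lin_resid ::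
  "'a measure \<Rightarrow> ('a \<Rightarrow> real) \<Rightarrow> ('a \<Rightarrow> real^'k) \<Rightarrow> 'k set \<Rightarrow> 'a \<Rightarrow> real" where
  "lin_resid M U V S =
     (let cb = (SOME cb :: real \<times> ('k \<Rightarrow> real). \<forall>c' b'.
          (\<integral>\<omega>. (U \<omega> - fst cb - (\<Sum>k\<in>S. snd cb k * V \<omega> $ k))\<^sup>2 \<partial>M)
            \<le> (\<integral>\<omega>. (U \<omega> - c' - (\<Sum>k\<in>S. b' k * V \<omega> $ k))\<^sup>2 \<partial>M))
      in (\<lambda>\<omega>. U \<omega> - fst cb - (\<Sum>k\<in>S. snd cb k * V \<omega> $ k)))"

text \<open>Partial correlation of entries i and j of V given all remaining entries of V.\<close>
definition partial_corr ::
  "'a measure \<Rightarrow> ('a \<Rightarrow> real^'k) \<Rightarrow> 'k \<Rightarrow> 'k \<Rightarrow> real" where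
  "partial_corr M V i j =
     corr M (lin_resid M (\<lambda>\<omega>. V \<omega> $ i) V (UNIV - {i, j}))
            (lin_resid M (\<lambda>\<omega>. V \<omega> $ j) V (UNIV - {i, j}))"

section \<open>Coordinates of (Y,Z,X,W), used for first and second moments\<close>

text \<open>The constant 1 together with all scalar coordinates of (y,z,x,w).
  Products f*g with f,g in this set range over all first and second moments.\<close>
definition coords :: "((real \<times> (real^'p) \<times> (real^'d) \<times> (real^'d)) \<Rightarrow> real) set" where
  "coords = {\<lambda>_. 1, \<lambda>(y,z,x,w). y}
     \<union> {\<lambda>(y,z,x,w). z $ k | k. True}
     \<union> {\<lambda>(y,z,x,w). x $ k | k. True}
     \<union> {\<lambda>(y,z,x,w). w $ k | k. True}"

end

(*
  The OLS coefficients of (Z, W) converge in probability to Cov(Z,W)^-1 Cov((Z,W), Y). Since the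
  measurement error E = W - X is independent of (Z, X, Y), it is uncorrelated with all of them, so
  Cov(Z,W) = Cov(Z,X) + diag(0, Sigma_E) and Cov((Z,W), Y) = Cov((Z,X), Y) = Cov(Z,X) beta by the
  population normal equations. Hence the limit is beta - Cov(Z,W)^-1 diag(0, Sigma_E) beta, whose
  X-part is beta_X - Omega Sigma_E beta_X with Omega the lower right block of Cov(Z,W)^-1, i.e. the
  inverse of the Schur complement Sigma_E + D - C^T A^-1 C.

  The diagonal of Omega lies in (0, 1/a_j] because u^T Cov(Z,W) u >= a_j u_j^2. For the off-diagonal
  entries, the partial correlation of X^(j) and X^(j') is -P_jj' / sqrt (P_jj P_j'j') for the precision
  matrix P = Cov(Z,X)^-1, so Pairwise Partial PC+ makes the off-diagonal of the X-block of P negative;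
  adding the nonnegative diagonal of Sigma_E one entry at a time keeps it nonpositive, by the
  Sherman-Morrison formula.

  Only population moments and the convergence of sample moments enter, and the population
  counterpart of condition (ii) follows from the independence of E.
*)

theory Submission
  imports Defs
begin

section \<open>Convergence in probability\<close>

lemma conv_in_probD:
  assumes "conv_in_prob M Xn c" "e > 0" "\<delta> > 0"
  shows "eventually (\<lambda>n. \<exists>A\<in>sets M. {\<omega>\<in>space M. dist (Xn n \<omega>) c > e} \<subseteq> A \<and> measure M A < \<delta>) sequentially"
  using assms unfolding conv_in_prob_def by blast

lemma conv_in_prob_transform:
  fixes Vn :: "nat \<Rightarrow> 'a \<Rightarrow> 'b::metric_space" and Bn :: "nat \<Rightarrow> 'a \<Rightarrow> 'c::metric_space"
  assumes conv: "conv_in_prob M Vn v"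
    and control: "\<And>e. e > 0 \<Longrightarrow> \<exists>d>0. \<forall>n>0. \<forall>\<omega>\<in>space M. dist (Vn n \<omega>) v < d \<longrightarrow> dist (Bn n \<omega>) b \<le> e"
  shows "conv_in_prob M Bn b"
  unfolding conv_in_prob_def
proof (intro allI impI)
  fix e \<delta> :: real assume "e > 0" "\<delta> > 0"
  then obtain d where "d > 0"
    and d: "\<forall>n>0. \<forall>\<omega>\<in>space M. dist (Vn n \<omega>) v < d \<longrightarrow> dist (Bn n \<omega>) b \<le> e/2"
    using control[of "e/2"] by auto
  have "eventually (\<lambda>n. \<exists>A\<in>sets M. {\<omega>\<in>space M. dist (Vn n \<omega>) v > d/2} \<subseteq> A \<and> measure M A < \<delta>) sequentially"
    using \<open>d > 0\<close> \<open>\<delta> > 0\<close> by (intro conv_in_probD[OF conv]) simp_all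
  then show "eventually (\<lambda>n. \<exists>A\<in>sets M. {\<omega>\<in>space M. dist (Bn n \<omega>) b > e} \<subseteq> A \<and> measure M A < \<delta>) sequentially"
    using eventually_gt_at_top[of 0]
  proof eventually_elim
    case (elim n)
    then obtain A where A: "A \<in> sets M" "{\<omega>\<in>space M. dist (Vn n \<omega>) v > d/2} \<subseteq> A" "measure M A < \<delta>"
      by blast
    have "{\<omega>\<in>space M. dist (Bn n \<omega>) b > e} \<subseteq> {\<omega>\<in>space M. dist (Vn n \<omega>) v > d/2}"
    proof safe
      fix \<omega> assume \<omega>: "\<omega> \<in> space M" "dist (Bn n \<omega>) b > e"
      have "\<not> dist (Vn n \<omega>) v < d"
      proof
        assume "dist (Vn n \<omega>) v < d"
        with d \<open>n > 0\<close> \<omega>(1) have "dist (Bn n \<omega>) b \<le> e/2" by blast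
        with \<omega>(2) \<open>e > 0\<close> show False by linarith
      qed
      then show "dist (Vn n \<omega>) v > d/2" using \<open>d > 0\<close> by linarith
    qed
    with A show ?case by blast
  qed
qed

lemma conv_in_prob_isCont:
  fixes Vn :: "nat \<Rightarrow> 'a \<Rightarrow> 'b::metric_space" and g :: "'b \<Rightarrow> 'c::metric_space"
  assumes "conv_in_prob M Vn v" and "isCont g v"
  shows "conv_in_prob M (\<lambda>n \<omega>. g (Vn n \<omega>)) (g v)"
proof (rule conv_in_prob_transform[OF assms(1)])
  fix e :: real assume "e > 0"
  then obtain d where "d > 0" and "\<forall>x. dist x v < d \<longrightarrow> dist (g x) (g v) < e"
    using \<open>isCont g v\<close> unfolding continuous_at_eps_delta by blast
  then show "\<exists>d>0. \<forall>n>0. \<forall>\<omega>\<in>space M. dist (Vn n \<omega>) v < d \<longrightarrow> dist (g (Vn n \<omega>)) (g v) \<le> e"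
    by (meson less_imp_le)
qed

lemma conv_in_prob_Pair:
  fixes Sn :: "nat \<Rightarrow> 'a \<Rightarrow> 'b::metric_space" and Vn :: "nat \<Rightarrow> 'a \<Rightarrow> 'c::metric_space"
  assumes U: "conv_in_prob M Sn u" and V: "conv_in_prob M Vn v"
  shows "conv_in_prob M (\<lambda>n \<omega>. (Sn n \<omega>, Vn n \<omega>)) (u, v)"
  unfolding conv_in_prob_def
proof (intro allI impI)
  fix e \<delta> :: real assume "e > 0" "\<delta> > 0"
  have "eventually (\<lambda>n. \<exists>A\<in>sets M. {\<omega>\<in>space M. dist (Sn n \<omega>) u > e/2} \<subseteq> A \<and> measure M A < \<delta>/2) sequentially"
    and "eventually (\<lambda>n. \<exists>A\<in>sets M. {\<omega>\<in>space M. dist (Vn n \<omega>) v > e/2} \<subseteq> A \<and> measure M A < \<delta>/2) sequentially"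
    using \<open>e > 0\<close> \<open>\<delta> > 0\<close> by (intro conv_in_probD[OF U] conv_in_probD[OF V]; simp)+
  then show "eventually (\<lambda>n. \<exists>A\<in>sets M. {\<omega>\<in>space M. dist (Sn n \<omega>, Vn n \<omega>) (u, v) > e} \<subseteq> A \<and> measure M A < \<delta>) sequentially"
  proof eventually_elim
    case (elim n)
    then obtain A1 A2 where A: "A1 \<in> sets M" "{\<omega>\<in>space M. dist (Sn n \<omega>) u > e/2} \<subseteq> A1" "measure M A1 < \<delta>/2"
      "A2 \<in> sets M" "{\<omega>\<in>space M. dist (Vn n \<omega>) v > e/2} \<subseteq> A2" "measure M A2 < \<delta>/2" by auto
    have sum_le: "dist (Sn n \<omega>, Vn n \<omega>) (u, v) \<le> dist (Sn n \<omega>) u + dist (Vn n \<omega>) v" for \<omega>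
      unfolding dist_Pair_Pair by (rule sqrt_sum_squares_le_sum) auto
    have "{\<omega>\<in>space M. dist (Sn n \<omega>, Vn n \<omega>) (u, v) > e} \<subseteq> A1 \<union> A2"
    proof safe
      fix \<omega> assume \<omega>: "\<omega> \<in> space M" "dist (Sn n \<omega>, Vn n \<omega>) (u, v) > e" "\<omega> \<notin> A2"
      then have "dist (Vn n \<omega>) v \<le> e/2" using A(5) by (auto simp: not_less)
      with \<omega>(2) have "dist (Sn n \<omega>) u > e/2" using sum_le[of \<omega>] by linarith
      with \<omega>(1) show "\<omega> \<in> A1" using A(2) by auto
    qed
    moreover have "measure M (A1 \<union> A2) < \<delta>"
      using measure_Un_le[OF A(1) A(4)] A by linarith
    ultimately show ?case using A by blast
  qed
qed

lemma measure_UNION_less: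
  assumes "finite I" "I \<noteq> {}" "\<And>k. k \<in> I \<Longrightarrow> A k \<in> sets M" "\<And>k. k \<in> I \<Longrightarrow> measure M (A k) < \<delta> / card I"
  shows "measure M (\<Union>k\<in>I. A k) < \<delta>"
proof -
  have "measure M (\<Union>k\<in>I. A k) \<le> (\<Sum>k\<in>I. measure M (A k))"
    using assms(1,3) by (rule measure_UNION_le)
  also have "\<dots> < (\<Sum>k\<in>I. \<delta> / card I)"
    using assms(1,2,4) by (rule sum_strict_mono)
  also have "\<dots> = \<delta>" using assms(1,2) by simp
  finally show ?thesis .
qed

lemma conv_in_prob_componentwise:
  fixes Xn :: "nat \<Rightarrow> 'a \<Rightarrow> ('b::real_normed_vector)^'k::finite"
  assumes conv: "\<And>k. conv_in_prob M (\<lambda>n \<omega>. Xn n \<omega> $ k) (u $ k)"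
  shows "conv_in_prob M Xn u"
  unfolding conv_in_prob_def
proof (intro allI impI)
  fix e \<delta> :: real assume "e > 0" "\<delta> > 0"
  define c where "c = real CARD('k)"
  have "c > 0" unfolding c_def by simp
  have "\<forall>k. eventually (\<lambda>n. \<exists>A\<in>sets M. {\<omega>\<in>space M. dist (Xn n \<omega> $ k) (u $ k) > e/c} \<subseteq> A \<and> measure M A < \<delta>/c) sequentially"
    using \<open>e > 0\<close> \<open>\<delta> > 0\<close> \<open>c > 0\<close> by (intro allI conv_in_probD[OF conv]) simp_all
  then have "eventually (\<lambda>n. \<forall>k. \<exists>A\<in>sets M. {\<omega>\<in>space M. dist (Xn n \<omega> $ k) (u $ k) > e/c} \<subseteq> A \<and> measure M A < \<delta>/c) sequentially"
    by (simp add: eventually_all_finite)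
  then show "eventually (\<lambda>n. \<exists>A\<in>sets M. {\<omega>\<in>space M. dist (Xn n \<omega>) u > e} \<subseteq> A \<and> measure M A < \<delta>) sequentially"
  proof eventually_elim
    case (elim n)
    then have "\<forall>k. \<exists>A. A \<in> sets M \<and> {\<omega>\<in>space M. dist (Xn n \<omega> $ k) (u $ k) > e/c} \<subseteq> A \<and> measure M A < \<delta>/c"
      by blast
    then obtain A where "\<forall>k. A k \<in> sets M \<and> {\<omega>\<in>space M. dist (Xn n \<omega> $ k) (u $ k) > e/c} \<subseteq> A k \<and> measure M (A k) < \<delta>/c"
      by (rule choice[THEN exE]) blast
    then have A: "\<And>k. A k \<in> sets M" "\<And>k. {\<omega>\<in>space M. dist (Xn n \<omega> $ k) (u $ k) > e/c} \<subseteq> A k"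
      "\<And>k. measure M (A k) < \<delta>/c" by auto
    have "{\<omega>\<in>space M. dist (Xn n \<omega>) u > e} \<subseteq> (\<Union>k. A k)"
    proof safe
      fix \<omega> assume \<omega>: "\<omega> \<in> space M" "dist (Xn n \<omega>) u > e"
      have "\<exists>k. dist (Xn n \<omega> $ k) (u $ k) > e/c"
      proof (rule ccontr)
        assume "\<nexists>k. dist (Xn n \<omega> $ k) (u $ k) > e/c"
        then have "(\<Sum>k\<in>UNIV. dist (Xn n \<omega> $ k) (u $ k)) \<le> (\<Sum>k\<in>(UNIV::'k set). e/c)"
          by (intro sum_mono) (simp add: not_less)
        moreover have "dist (Xn n \<omega>) u \<le> (\<Sum>k\<in>UNIV. dist (Xn n \<omega> $ k) (u $ k))"
          unfolding dist_vec_def by (rule L2_set_le_sum) auto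
        ultimately show False using \<omega>(2) \<open>c > 0\<close> unfolding c_def by simp
      qed
      then show "\<omega> \<in> (\<Union>k. A k)" using A(2) \<omega>(1) by blast
    qed
    moreover have "measure M (\<Union>k. A k) < \<delta>"
      using measure_UNION_less[of UNIV A M \<delta>] A unfolding c_def by simp
    moreover have "(\<Union>k. A k) \<in> sets M" using A by auto
    ultimately show ?case by blast
  qed
qed

lemma conv_in_prob_diff_const:
  fixes Xn :: "nat \<Rightarrow> 'a \<Rightarrow> 'b::real_normed_vector"
  assumes "conv_in_prob M Xn x"
  shows "conv_in_prob M (\<lambda>n \<omega>. Xn n \<omega> - c) (x - c)"
proof -
  have "isCont (\<lambda>v. v - c) x" by (intro continuous_intros)
  with assms show ?thesis by (rule conv_in_prob_isCont)
qed

section \<open>Square-integrable random variables and covariances\<close>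

definition L2 :: "'a measure \<Rightarrow> ('a \<Rightarrow> real) set" where
  "L2 M = {f. f \<in> borel_measurable M \<and> integrable M (\<lambda>x. (f x)\<^sup>2)}"

lemma cov_sym: "cov M f g = cov M g f"
  unfolding cov_def by (simp add: mult.commute)

lemma cov_scale_left: "cov M (\<lambda>x. c * f x) h = c * cov M f h"
  unfolding cov_def by (simp add: algebra_simps)

lemma L2_uniform_count_measure: "finite A \<Longrightarrow> f \<in> L2 (uniform_count_measure A)"
  unfolding L2_def uniform_count_measure_def
  by (simp add: integrable_point_measure_finite sets_point_measure)

lemma covmat_transpose: "covmat M V U = transpose (covmat M U V)"
  by (simp add: covmat_def transpose_def cov_sym)

context prob_space
begin

lemma L2I: "f \<in> borel_measurable M \<Longrightarrow> integrable M (\<lambda>x. (f x)\<^sup>2) \<Longrightarrow> f \<in> L2 M"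
  unfolding L2_def by auto

lemma L2_integrable: "f \<in> L2 M \<Longrightarrow> integrable M f"
  unfolding L2_def by (auto intro: square_integrable_imp_integrable)

lemma L2_integrable_mult:
  assumes "f \<in> L2 M" "g \<in> L2 M"
  shows "integrable M (\<lambda>x. f x * g x)"
proof (rule Bochner_Integration.integrable_bound[where f="\<lambda>x. (f x)\<^sup>2 + (g x)\<^sup>2"])
  show "integrable M (\<lambda>x. (f x)\<^sup>2 + (g x)\<^sup>2)" "(\<lambda>x. f x * g x) \<in> borel_measurable M"
    using assms unfolding L2_def by auto
  have "\<bar>f x * g x\<bar> \<le> (f x)\<^sup>2 + (g x)\<^sup>2" for x
  proof -
    have "0 \<le> (\<bar>f x\<bar> - \<bar>g x\<bar>)\<^sup>2" by simp
    then have "2 * \<bar>f x * g x\<bar> \<le> (f x)\<^sup>2 + (g x)\<^sup>2"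
      by (simp add: power2_eq_square abs_mult algebra_simps)
    then show ?thesis by simp
  qed
  then show "AE x in M. norm (f x * g x) \<le> norm ((f x)\<^sup>2 + (g x)\<^sup>2)"
    by simp
qed

lemma L2_const: "(\<lambda>_. c) \<in> L2 M"
  unfolding L2_def by auto

lemma L2_add:
  assumes "f \<in> L2 M" "g \<in> L2 M"
  shows "(\<lambda>x. f x + g x) \<in> L2 M"
proof (rule L2I)
  show "(\<lambda>x. f x + g x) \<in> borel_measurable M" using assms unfolding L2_def by auto
  have "integrable M (\<lambda>x. (f x)\<^sup>2 + (g x)\<^sup>2 + 2 * (f x * g x))"
    using assms L2_integrable_mult[OF assms] unfolding L2_def by auto
  then show "integrable M (\<lambda>x. (f x + g x)\<^sup>2)"
    by (simp add: power2_sum mult.assoc)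
qed

lemma L2_scale:
  assumes "f \<in> L2 M"
  shows "(\<lambda>x. c * f x) \<in> L2 M"
proof (rule L2I)
  show "(\<lambda>x. c * f x) \<in> borel_measurable M" using assms unfolding L2_def by auto
  have "integrable M (\<lambda>x. c\<^sup>2 * (f x)\<^sup>2)" using assms unfolding L2_def by auto
  then show "integrable M (\<lambda>x. (c * f x)\<^sup>2)" by (simp add: power_mult_distrib)
qed

lemma L2_diff: "f \<in> L2 M \<Longrightarrow> g \<in> L2 M \<Longrightarrow> (\<lambda>x. f x - g x) \<in> L2 M"
  using L2_add[OF _ L2_scale, of f g "-1"] by simp

lemma L2_sum: "(\<And>i. i \<in> I \<Longrightarrow> f i \<in> L2 M) \<Longrightarrow> (\<lambda>x. \<Sum>i\<in>I. f i x) \<in> L2 M"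
  by (induction I rule: infinite_finite_induct) (simp_all add: L2_const L2_add)

lemma L2_affine: "(\<And>i. i \<in> I \<Longrightarrow> f i \<in> L2 M) \<Longrightarrow> (\<lambda>x. c + (\<Sum>i\<in>I. b i * f i x)) \<in> L2 M"
  by (intro L2_add L2_const L2_sum L2_scale)

lemma L2_inner:
  fixes V :: "'a \<Rightarrow> real^'k::finite"
  shows "(\<And>k. (\<lambda>x. V x $ k) \<in> L2 M) \<Longrightarrow> (\<lambda>x. V x \<bullet> b) \<in> L2 M"
  using L2_affine[of UNIV "\<lambda>k x. V x $ k" 0 "\<lambda>k. b $ k"] by (simp add: inner_vec_def mult.commute)

lemma cov_const_left: "cov M (\<lambda>x. c) h = 0"
  unfolding cov_def by (simp add: prob_space)

lemma cov_add_left: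
  assumes "f \<in> L2 M" "g \<in> L2 M" "h \<in> L2 M"
  shows "cov M (\<lambda>x. f x + g x) h = cov M f h + cov M g h"
  using L2_integrable[OF assms(1)] L2_integrable[OF assms(2)]
    L2_integrable_mult[OF assms(1,3)] L2_integrable_mult[OF assms(2,3)]
  unfolding cov_def by (simp add: distrib_right algebra_simps)

lemma cov_add_right:
  "f \<in> L2 M \<Longrightarrow> g \<in> L2 M \<Longrightarrow> h \<in> L2 M \<Longrightarrow> cov M h (\<lambda>x. f x + g x) = cov M h f + cov M h g"
  using cov_add_left by (simp add: cov_sym)

lemma cov_sum_left:
  assumes "\<And>i. i \<in> I \<Longrightarrow> f i \<in> L2 M" "h \<in> L2 M"
  shows "cov M (\<lambda>x. \<Sum>i\<in>I. f i x) h = (\<Sum>i\<in>I. cov M (f i) h)"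
  using assms
proof (induction I rule: infinite_finite_induct)
  case (insert i I)
  then have "cov M (\<lambda>x. f i x + (\<Sum>i\<in>I. f i x)) h = cov M (f i) h + cov M (\<lambda>x. \<Sum>i\<in>I. f i x) h"
    by (intro cov_add_left L2_sum) auto
  with insert show ?case by simp
qed (simp_all add: cov_const_left)

lemma cov_affine_left:
  assumes "\<And>i. i \<in> I \<Longrightarrow> f i \<in> L2 M" "h \<in> L2 M"
  shows "cov M (\<lambda>x. c + (\<Sum>i\<in>I. b i * f i x)) h = (\<Sum>i\<in>I. b i * cov M (f i) h)"
proof -
  have "cov M (\<lambda>x. c + (\<Sum>i\<in>I. b i * f i x)) h = cov M (\<lambda>x. c) h + cov M (\<lambda>x. \<Sum>i\<in>I. b i * f i x) h"
    by (intro cov_add_left L2_const L2_sum L2_scale assms)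
  also have "\<dots> = (\<Sum>i\<in>I. b i * cov M (f i) h)"
    by (simp add: cov_const_left cov_sum_left L2_scale assms cov_scale_left)
  finally show ?thesis .
qed

lemma cov_affine_right:
  assumes "\<And>i. i \<in> I \<Longrightarrow> f i \<in> L2 M" "h \<in> L2 M"
  shows "cov M h (\<lambda>x. c + (\<Sum>i\<in>I. b i * f i x)) = (\<Sum>i\<in>I. b i * cov M h (f i))"
  using cov_affine_left[OF assms] by (simp add: cov_sym)

lemma integral_square_eq_cov: "(\<integral>x. (f x)\<^sup>2 \<partial>M) = cov M f f + (\<integral>x. f x \<partial>M)\<^sup>2"
  unfolding cov_def by (simp add: power2_eq_square)

end

lemma sigma_sets_vimage_comp_subset:
  assumes f: "f \<in> borel_measurable borel"
  shows "sigma_sets (space M) {(\<lambda>\<omega>. f (E \<omega>)) -` A \<inter> space M | A. A \<in> sets (borel :: real measure)}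
       \<subseteq> sigma_sets (space M) {E -` A \<inter> space M | A. A \<in> sets (borel :: ('x::topological_space) measure)}"
proof (rule sigma_sets_mono, safe)
  fix A :: "real set" assume A: "A \<in> sets borel"
  have "(\<lambda>\<omega>. f (E \<omega>)) -` A \<inter> space M = E -` (f -` A \<inter> space borel) \<inter> space M" by auto
  moreover have "f -` A \<inter> space borel \<in> sets (borel :: 'x measure)" using measurable_sets[OF f A] .
  ultimately show "(\<lambda>\<omega>. f (E \<omega>)) -` A \<inter> space M \<in> sigma_sets (space M) {E -` A \<inter> space M | A. A \<in> sets (borel :: 'x measure)}"
    by (auto intro!: sigma_sets.Basic)
qed

lemma (in prob_space) indep_set_vimage_integral_mult:
  fixes E :: "'a \<Rightarrow> 'x::topological_space" and T :: "'a \<Rightarrow> 'y::topological_space"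
    and f :: "'x \<Rightarrow> real" and g :: "'y \<Rightarrow> real"
  assumes indep: "indep_set (sets (vimage_algebra (space M) E borel)) (sets (vimage_algebra (space M) T borel))"
    and "E \<in> borel_measurable M" "T \<in> borel_measurable M"
    and f: "f \<in> borel_measurable borel" and g: "g \<in> borel_measurable borel"
    and "integrable M (\<lambda>\<omega>. f (E \<omega>))" "integrable M (\<lambda>\<omega>. g (T \<omega>))"
  shows "(\<integral>\<omega>. f (E \<omega>) * g (T \<omega>) \<partial>M) = (\<integral>\<omega>. f (E \<omega>) \<partial>M) * (\<integral>\<omega>. g (T \<omega>) \<partial>M)"
proof -
  have "indep_set (sigma_sets (space M) {(\<lambda>\<omega>. f (E \<omega>)) -` A \<inter> space M | A. A \<in> sets borel})
                  (sigma_sets (space M) {(\<lambda>\<omega>. g (T \<omega>)) -` A \<inter> space M | A. A \<in> sets borel})"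
    using indep unfolding indep_set_def sets_vimage_algebra
    by (rule indep_sets_mono_sets)
      (auto split: bool.split intro!: sigma_sets_vimage_comp_subset f g)
  then have "indep_var borel (\<lambda>\<omega>. f (E \<omega>)) borel (\<lambda>\<omega>. g (T \<omega>))"
    unfolding indep_var_eq using measurable_compose[OF _ f] measurable_compose[OF _ g] assms(2,3)
    by auto
  then show ?thesis by (rule indep_var_lebesgue_integral) fact+
qed

section \<open>Least squares and the normal equations\<close>

lemma le_quadratic_imp_zero:
  fixes a b :: real
  assumes le: "\<And>t. t * a \<le> t\<^sup>2 * b"
  shows "a = 0"
proof (rule ccontr)
  assume "a \<noteq> 0"
  define t where "t = a / (\<bar>b\<bar> + 1)"
  have ta: "t * a > 0" unfolding t_def using \<open>a \<noteq> 0\<close> by (simp add: power2_eq_square[symmetric] add_pos_nonneg)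
  have "t\<^sup>2 * b \<le> t\<^sup>2 * \<bar>b\<bar>" by (intro mult_left_mono) auto
  also have "\<dots> = (t * a) * (\<bar>b\<bar> / (\<bar>b\<bar> + 1))" unfolding t_def by (simp add: power2_eq_square)
  also have "\<dots> < (t * a) * 1" using ta by (intro mult_strict_left_mono) auto
  finally show False using le[of t] by simp
qed

lemma (in prob_space) least_squares_normal_equations:
  fixes V :: "'a \<Rightarrow> real^'k::finite" and Y :: "'a \<Rightarrow> real"
  assumes V: "\<And>k. (\<lambda>\<omega>. V \<omega> $ k) \<in> L2 M" and Y: "Y \<in> L2 M"
    and min: "\<And>c' b'. (\<integral>\<omega>. (Y \<omega> - c - V \<omega> \<bullet> b)\<^sup>2 \<partial>M) \<le> (\<integral>\<omega>. (Y \<omega> - c' - V \<omega> \<bullet> b')\<^sup>2 \<partial>M)"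
  shows "covmat M V V *v b = (\<chi> k. cov M (\<lambda>\<omega>. V \<omega> $ k) Y)"
proof -
  define \<epsilon> where "\<epsilon> \<omega> = Y \<omega> - c - V \<omega> \<bullet> b" for \<omega>
  have L\<epsilon>: "\<epsilon> \<in> L2 M" unfolding \<epsilon>_def by (intro L2_diff Y L2_const L2_inner V)
  have orth: "(\<integral>\<omega>. \<epsilon> \<omega> * (h0 + V \<omega> \<bullet> h) \<partial>M) = 0" for h0 h
  proof -
    define g where "g \<omega> = h0 + V \<omega> \<bullet> h" for \<omega>
    have Lg: "g \<in> L2 M" unfolding g_def by (intro L2_add L2_const L2_inner V)
    have "2 * (\<integral>\<omega>. \<epsilon> \<omega> * g \<omega> \<partial>M) = 0"
    proof (rule le_quadratic_imp_zero)
      fix t :: real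
      have "(\<integral>\<omega>. (\<epsilon> \<omega>)\<^sup>2 \<partial>M) \<le> (\<integral>\<omega>. (Y \<omega> - (c + t * h0) - V \<omega> \<bullet> (b + t *\<^sub>R h))\<^sup>2 \<partial>M)"
        using min unfolding \<epsilon>_def .
      also have "\<dots> = (\<integral>\<omega>. (\<epsilon> \<omega>)\<^sup>2 - 2 * t * (\<epsilon> \<omega> * g \<omega>) + t\<^sup>2 * (g \<omega>)\<^sup>2 \<partial>M)"
        unfolding \<epsilon>_def g_def
        by (intro Bochner_Integration.integral_cong refl) (simp add: inner_add_right power2_eq_square algebra_simps)
      also have "\<dots> = (\<integral>\<omega>. (\<epsilon> \<omega>)\<^sup>2 \<partial>M) - 2 * t * (\<integral>\<omega>. \<epsilon> \<omega> * g \<omega> \<partial>M) + t\<^sup>2 * (\<integral>\<omega>. (g \<omega>)\<^sup>2 \<partial>M)"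
        using L\<epsilon> Lg L2_integrable_mult[OF L\<epsilon> Lg] unfolding L2_def by simp
      finally show "t * (2 * (\<integral>\<omega>. \<epsilon> \<omega> * g \<omega> \<partial>M)) \<le> t\<^sup>2 * (\<integral>\<omega>. (g \<omega>)\<^sup>2 \<partial>M)"
        by simp
    qed
    then show ?thesis by (simp add: g_def)
  qed
  have mean: "(\<integral>\<omega>. \<epsilon> \<omega> \<partial>M) = 0" using orth[of 1 0] by simp
  have uncorr: "cov M (\<lambda>\<omega>. V \<omega> $ k) \<epsilon> = 0" for k
    using orth[of 0 "axis k 1"] mean unfolding cov_def by (simp add: inner_axis mult.commute)
  have Y_eq: "Y = (\<lambda>\<omega>. (c + (\<Sum>l\<in>UNIV. b $ l * V \<omega> $ l)) + \<epsilon> \<omega>)"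
    unfolding \<epsilon>_def by (simp add: inner_vec_def mult.commute)
  show ?thesis
  proof (subst vec_eq_iff, intro allI)
    fix k
    have "cov M (\<lambda>\<omega>. V \<omega> $ k) Y = (\<Sum>l\<in>UNIV. b $ l * cov M (\<lambda>\<omega>. V \<omega> $ k) (\<lambda>\<omega>. V \<omega> $ l))"
      unfolding Y_eq
      by (simp add: cov_add_right[OF L2_affine[OF V] L\<epsilon> V] cov_affine_right[OF V V] uncorr)
    then show "(covmat M V V *v b) $ k = (\<chi> k. cov M (\<lambda>\<omega>. V \<omega> $ k) Y) $ k"
      by (simp add: matrix_vector_mult_def covmat_def mult.commute)
  qed
qed

lemma ols_normal_equations:
  fixes y :: "nat \<Rightarrow> real" and v :: "nat \<Rightarrow> real^'k::finite"
  assumes "N > 0"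
    and min: "\<And>c' b'. (\<Sum>i<N. (y i - c - v i \<bullet> b)\<^sup>2) \<le> (\<Sum>i<N. (y i - c' - v i \<bullet> b')\<^sup>2)"
  shows "covmat (uniform_count_measure {..<N}) v v *v b = (\<chi> k. cov (uniform_count_measure {..<N}) (\<lambda>i. v i $ k) y)"
proof -
  interpret prob_space "uniform_count_measure {..<N}"
    using \<open>N > 0\<close> by (intro prob_space_uniform_count_measure) auto
  show ?thesis
  proof (rule least_squares_normal_equations[where c=c])
    show "(\<integral>i. (y i - c - v i \<bullet> b)\<^sup>2 \<partial>uniform_count_measure {..<N})
        \<le> (\<integral>i. (y i - c' - v i \<bullet> b')\<^sup>2 \<partial>uniform_count_measure {..<N})" for c' b'
      using divide_right_mono[OF min[of c' b'], of "real N"] by (simp add: integral_uniform_count_measure)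
  qed (simp_all add: L2_uniform_count_measure)
qed

section \<open>Inverses of positive definite matrices\<close>

lemma matrix_inv:
  assumes "invertible A"
  shows matrix_inv_right: "A ** matrix_inv A = mat 1" and matrix_inv_left: "matrix_inv A ** A = mat 1"
  using someI_ex[OF assms[unfolded invertible_def]] unfolding matrix_inv_def by auto

lemma matrix_inv_eq:
  fixes A :: "real^'n^'n"
  assumes "A ** B = mat 1"
  shows "matrix_inv A = B"
proof -
  have "invertible A" using assms matrix_left_right_inverse unfolding invertible_def by blast
  then have "matrix_inv A = matrix_inv A ** (A ** B)" using assms by simp
  also have "\<dots> = B" using matrix_inv_left[OF \<open>invertible A\<close>] by (simp add: matrix_mul_assoc)
  finally show ?thesis .
qed

lemma matrix_inv_eq_left:
  fixes A :: "real^'n^'n"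
  assumes "B ** A = mat 1"
  shows "matrix_inv A = B"
proof -
  have "A ** B = mat 1" using assms matrix_left_right_inverse by blast
  then show ?thesis by (rule matrix_inv_eq)
qed

lemma pos_def_mat_nonneg: "pos_def_mat S \<Longrightarrow> 0 \<le> u \<bullet> (S *v u)"
  unfolding pos_def_mat_def by (cases "u = 0") (auto intro: less_imp_le)

lemma pos_def_mat_invertible:
  fixes S :: "real^'n^'n"
  assumes "pos_def_mat S"
  shows "invertible S"
proof -
  have "S *v x = 0 \<Longrightarrow> x = 0" for x
    using assms unfolding pos_def_mat_def by (metis inner_zero_right less_irrefl)
  then obtain P where "P ** S = mat 1" using matrix_left_invertible_ker by blast
  then show ?thesis using matrix_left_right_inverse unfolding invertible_def by blast
qed

lemma symmetric_matrix_inv: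
  fixes S :: "real^'n^'n"
  assumes "transpose S = S" "invertible S"
  shows "matrix_inv S $ i $ j = matrix_inv S $ j $ i"
proof -
  have "S ** transpose (matrix_inv S) = mat 1"
    using arg_cong[OF matrix_inv_left[OF assms(2)], of transpose] assms(1)
    by (simp add: matrix_transpose_mul)
  then have "matrix_inv S = transpose (matrix_inv S)" by (rule matrix_inv_eq)
  then show ?thesis by (metis transpose_def vec_lambda_beta)
qed

lemma matrix_inv_quadratic_form:
  fixes S :: "real^'n^'n" and j :: 'n
  assumes "invertible S"
  defines "q \<equiv> matrix_inv S *v axis j 1"
  shows "S *v q = axis j 1" "q $ j = matrix_inv S $ j $ j" "q \<bullet> (S *v q) = matrix_inv S $ j $ j"
proof -
  show Sq: "S *v q = axis j 1"
    unfolding q_def using matrix_inv_right[OF assms(1)] by (simp add: matrix_vector_mul_assoc)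
  show qj: "q $ j = matrix_inv S $ j $ j"
    unfolding q_def by (simp add: matrix_vector_mult_basis column_def)
  show "q \<bullet> (S *v q) = matrix_inv S $ j $ j"
    unfolding Sq by (simp add: inner_axis qj)
qed

lemma pos_def_matrix_inv_diag_pos:
  fixes S :: "real^'n^'n"
  assumes "pos_def_mat S"
  shows "0 < matrix_inv S $ j $ j"
proof -
  note q = matrix_inv_quadratic_form[OF pos_def_mat_invertible[OF assms], of j]
  have "matrix_inv S *v axis j 1 \<noteq> 0"
    using q(1) by (metis axis_nth matrix_vector_mult_0_right one_neq_zero zero_index)
  then have "0 < (matrix_inv S *v axis j 1) \<bullet> (S *v (matrix_inv S *v axis j 1))"
    using assms unfolding pos_def_mat_def by blast
  then show ?thesis using q(3) by simp
qed

lemma pos_def_matrix_inv_diag_le: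
  fixes S :: "real^'n^'n"
  assumes "pos_def_mat S" and bound: "\<And>u. a * (u $ j)\<^sup>2 \<le> u \<bullet> (S *v u)" and "0 < a"
  shows "matrix_inv S $ j $ j \<le> 1 / a"
proof -
  note q = matrix_inv_quadratic_form[OF pos_def_mat_invertible[OF assms(1)], of j]
  have pos: "0 < matrix_inv S $ j $ j" by (rule pos_def_matrix_inv_diag_pos[OF assms(1)])
  have "a * (matrix_inv S $ j $ j)\<^sup>2 \<le> matrix_inv S $ j $ j"
    using bound[of "matrix_inv S *v axis j 1"] q(2,3) by simp
  then have "a * matrix_inv S $ j $ j \<le> 1"
    using pos by (simp add: power2_eq_square)
  then show ?thesis using \<open>0 < a\<close> by (simp add: field_simps)
qed

section \<open>Diagonal updates of inverses\<close>

definition diag_on :: "'n set \<Rightarrow> ('n \<Rightarrow> real) \<Rightarrow> real^'n^'n" where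
  "diag_on F a = (\<chi> k l. if k = l \<and> k \<in> F then a k else 0)"

definition nonpos_offdiag_on :: "'n set \<Rightarrow> real^'n^'n \<Rightarrow> bool" where
  "nonpos_offdiag_on J P \<longleftrightarrow> (\<forall>k\<in>J. \<forall>l\<in>J. k \<noteq> l \<longrightarrow> P $ k $ l \<le> 0)"

lemma inner_diag_on: "u \<bullet> (diag_on F a *v u) = (\<Sum>k\<in>F. a k * (u $ k)\<^sup>2)"
proof -
  have "diag_on F a *v u = (\<chi> k. if k \<in> F then a k * u $ k else 0)"
    by (simp add: diag_on_def vec_eq_iff matrix_vector_mult_def if_distrib if_distribR cong: if_cong)
  then have "u \<bullet> (diag_on F a *v u) = (\<Sum>k\<in>UNIV. if k \<in> F then a k * (u $ k)\<^sup>2 else 0)"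
    by (simp add: inner_vec_def if_distrib power2_eq_square algebra_simps cong: if_cong)
  also have "\<dots> = (\<Sum>k\<in>F. a k * (u $ k)\<^sup>2)"
    by (simp add: sum.inter_restrict[symmetric])
  finally show ?thesis .
qed

lemma pos_def_add_diag_on:
  fixes S :: "real^'n^'n"
  assumes "pos_def_mat S" "\<And>k. 0 \<le> a k"
  shows "pos_def_mat (S + diag_on F a)"
  unfolding pos_def_mat_def
proof (intro conjI allI impI)
  show "transpose (S + diag_on F a) = S + diag_on F a"
    using assms(1) unfolding pos_def_mat_def by (auto simp: transpose_def vec_eq_iff diag_on_def)
  fix u :: "real^'n" assume "u \<noteq> 0"
  then have "0 < u \<bullet> (S *v u)" using assms(1) unfolding pos_def_mat_def by blast
  moreover have "0 \<le> (\<Sum>k\<in>F. a k * (u $ k)\<^sup>2)" using assms(2) by (intro sum_nonneg) simp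
  ultimately show "0 < u \<bullet> ((S + diag_on F a) *v u)"
    by (simp add: matrix_vector_mult_add_rdistrib inner_add_right inner_diag_on)
qed

lemma matrix_inv_add_diag_single:
  fixes S :: "real^'n^'n"
  assumes "invertible S" and nonzero: "1 + a * matrix_inv S $ j $ j \<noteq> 0"
  shows "matrix_inv (S + diag_on {j} (\<lambda>_. a)) = (\<chi> k l. matrix_inv S $ k $ l
    - a / (1 + a * matrix_inv S $ j $ j) * matrix_inv S $ k $ j * matrix_inv S $ j $ l)"
proof -
  define P where "P = matrix_inv S"
  define c where "c = a / (1 + a * P $ j $ j)"
  have key: "a * (1 - c * P $ j $ j) = c"
    using nonzero unfolding c_def P_def by (simp add: field_simps)
  have SP: "(\<Sum>m\<in>UNIV. S $ k $ m * P $ m $ l) = (if k = l then 1 else 0)" for k l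
  proof -
    have "(S ** P) $ k $ l = mat 1 $ k $ l"
      unfolding P_def by (simp add: matrix_inv_right[OF assms(1)])
    then show ?thesis by (simp add: matrix_matrix_mult_def mat_def)
  qed
  have delta: "(\<Sum>m\<in>UNIV. (if m = j then a else 0) * f m) = a * f j" for f :: "'n \<Rightarrow> real"
    by (subst sum.remove[of _ j]) auto
  have diag: "diag_on {j} (\<lambda>_. a) = (\<chi> k l. if k = j \<and> l = j then a else 0)"
    by (auto simp: diag_on_def vec_eq_iff)
  define P' where "P' = (\<chi> k l. P $ k $ l - c * P $ k $ j * P $ j $ l)"
  have "(S + diag_on {j} (\<lambda>_. a)) ** P' = mat 1"
  proof (subst vec_eq_iff, intro allI, subst vec_eq_iff, intro allI)
    fix k l
    have "((S + diag_on {j} (\<lambda>_. a)) ** P') $ k $ l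
        = (\<Sum>m\<in>UNIV. S $ k $ m * P $ m $ l) - c * (\<Sum>m\<in>UNIV. S $ k $ m * P $ m $ j) * P $ j $ l
          + (\<Sum>m\<in>UNIV. (if k = j \<and> m = j then a else 0) * (P $ m $ l - c * P $ m $ j * P $ j $ l))"
      unfolding P'_def diag
      by (simp add: matrix_matrix_mult_def algebra_simps sum.distrib sum_subtractf sum_distrib_left
          sum_distrib_right)
    also have "(\<Sum>m\<in>UNIV. (if k = j \<and> m = j then a else 0) * (P $ m $ l - c * P $ m $ j * P $ j $ l))
        = (if k = j then a * (P $ j $ l - c * P $ j $ j * P $ j $ l) else 0)"
      by (cases "k = j") (simp_all add: delta)
    also have "(\<Sum>m\<in>UNIV. S $ k $ m * P $ m $ l) - c * (\<Sum>m\<in>UNIV. S $ k $ m * P $ m $ j) * P $ j $ l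
          + (if k = j then a * (P $ j $ l - c * P $ j $ j * P $ j $ l) else 0) = mat 1 $ k $ l"
    proof (cases "k = j")
      case True
      have "a * (P $ j $ l - c * P $ j $ j * P $ j $ l) = c * P $ j $ l"
        using arg_cong[OF key, of "\<lambda>x. x * P $ j $ l"] by (simp add: algebra_simps)
      with True show ?thesis unfolding SP by (simp add: mat_def)
    qed (simp add: SP mat_def)
    finally show "((S + diag_on {j} (\<lambda>_. a)) ** P') $ k $ l = mat 1 $ k $ l" .
  qed
  then show ?thesis unfolding P'_def c_def P_def by (rule matrix_inv_eq)
qed

text \<open>By Sherman--Morrison, an off-diagonal entry of the new inverse is either an old one scaled by
  \<open>1/(1 + a P\<^sub>j\<^sub>j) > 0\<close> or an old one minus a nonnegative multiple of a product of two old ones.\<close>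
lemma nonpos_offdiag_on_inverse_add_diag_single:
  fixes S :: "real^'n^'n"
  assumes pd: "pos_def_mat S" and nonpos: "nonpos_offdiag_on J (matrix_inv S)"
    and "j \<in> J" "0 \<le> a"
  shows "nonpos_offdiag_on J (matrix_inv (S + diag_on {j} (\<lambda>_. a)))"
proof -
  define P where "P = matrix_inv S"
  have "0 < P $ j $ j" unfolding P_def by (rule pos_def_matrix_inv_diag_pos[OF pd])
  then have "0 < 1 + a * P $ j $ j" using \<open>0 \<le> a\<close> by (simp add: add_pos_nonneg)
  define c where "c = a / (1 + a * P $ j $ j)"
  have "0 \<le> c" unfolding c_def using \<open>0 \<le> a\<close> \<open>0 < 1 + a * P $ j $ j\<close> by simp
  have "0 < 1 - c * P $ j $ j"
    unfolding c_def using \<open>0 < 1 + a * P $ j $ j\<close> by (simp add: field_simps)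
  have inv: "matrix_inv (S + diag_on {j} (\<lambda>_. a)) = (\<chi> k l. P $ k $ l - c * P $ k $ j * P $ j $ l)"
    unfolding c_def P_def
    by (rule matrix_inv_add_diag_single[OF pos_def_mat_invertible[OF pd]])
      (use \<open>0 < 1 + a * P $ j $ j\<close> in \<open>simp add: P_def\<close>)
  have nonpos': "P $ k $ l \<le> 0" if "k \<in> J" "l \<in> J" "k \<noteq> l" for k l
    using nonpos that unfolding nonpos_offdiag_on_def P_def by blast
  show ?thesis
    unfolding nonpos_offdiag_on_def inv
  proof (intro ballI impI)
    fix k l assume "k \<in> J" "l \<in> J" "k \<noteq> l"
    consider "k = j" | "l = j" | "k \<noteq> j" "l \<noteq> j" by blast
    then show "(\<chi> k l. P $ k $ l - c * P $ k $ j * P $ j $ l) $ k $ l \<le> 0"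
    proof cases
      case 1
      then show ?thesis
        using nonpos'[of j l] \<open>l \<in> J\<close> \<open>k \<noteq> l\<close> \<open>j \<in> J\<close> \<open>0 < 1 - c * P $ j $ j\<close>
          mult_nonpos_nonneg[of "P $ j $ l" "1 - c * P $ j $ j"]
        by (simp add: algebra_simps)
    next
      case 2
      then show ?thesis
        using nonpos'[of k j] \<open>k \<in> J\<close> \<open>k \<noteq> l\<close> \<open>j \<in> J\<close> \<open>0 < 1 - c * P $ j $ j\<close>
          mult_nonpos_nonneg[of "P $ k $ j" "1 - c * P $ j $ j"]
        by (simp add: algebra_simps)
    next
      case 3
      then have "0 \<le> c * P $ k $ j * P $ j $ l"
        using nonpos'[of k j] nonpos'[of j l] \<open>k \<in> J\<close> \<open>l \<in> J\<close> \<open>j \<in> J\<close> \<open>0 \<le> c\<close>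
        by (simp add: mult_nonpos_nonpos mult.assoc)
      then show ?thesis using nonpos'[OF \<open>k \<in> J\<close> \<open>l \<in> J\<close> \<open>k \<noteq> l\<close>] by simp
    qed
  qed
qed

lemma nonpos_offdiag_on_inverse_add_diag_on:
  fixes S :: "real^'n^'n"
  assumes pd: "pos_def_mat S" and nonpos: "nonpos_offdiag_on J (matrix_inv S)"
    and "F \<subseteq> J" and a: "\<And>k. 0 \<le> a k"
  shows "nonpos_offdiag_on J (matrix_inv (S + diag_on F a))"
  using finite[of F] \<open>F \<subseteq> J\<close>
proof (induction F rule: finite_induct)
  case empty
  have "diag_on {} a = 0" by (simp add: diag_on_def vec_eq_iff)
  then show ?case using nonpos by simp
next
  case (insert j F)
  have "S + diag_on (insert j F) a = (S + diag_on F a) + diag_on {j} (\<lambda>_. a j)"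
    using insert(2) by (auto simp: diag_on_def vec_eq_iff)
  moreover have "nonpos_offdiag_on J (matrix_inv ((S + diag_on F a) + diag_on {j} (\<lambda>_. a j)))"
    using insert by (intro nonpos_offdiag_on_inverse_add_diag_single pos_def_add_diag_on[OF pd a] a) auto
  ultimately show ?case by (simp add: add.assoc)
qed

section \<open>Block matrices and the Schur complement\<close>

lemma sum_UNIV_Plus: "(\<Sum>x\<in>(UNIV::('a::finite + 'b::finite) set). f x) = (\<Sum>i\<in>UNIV. f (Inl i)) + (\<Sum>j\<in>UNIV. f (Inr j))"
  by (subst UNIV_Plus_UNIV[symmetric], subst sum.Plus) (simp_all add: comp_def)

lemma stack_nth [simp]: "stack u v $ Inl i = u $ i" "stack u v $ Inr j = v $ j"
  by (simp_all add: stack_def)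

lemma stack_eq_iff: "w = stack u v \<longleftrightarrow> (\<forall>i. w $ Inl i = u $ i) \<and> (\<forall>j. w $ Inr j = v $ j)"
  by (auto simp: vec_eq_iff stack_def split: sum.split)

lemma inner_stack: "stack u v \<bullet> stack u' v' = u \<bullet> u' + v \<bullet> v'"
  by (simp add: inner_vec_def sum_UNIV_Plus)

lemma inner_stack_split: "stack u v \<bullet> b = u \<bullet> (\<chi> i. b $ Inl i) + v \<bullet> (\<chi> j. b $ Inr j)"
  by (simp add: inner_vec_def sum_UNIV_Plus)

lemma stack_diff: "stack u v - stack u' v' = stack (u - u') (v - v')"
  by (simp add: stack_eq_iff)

lemma norm_le_norm_stack: "norm v \<le> norm (stack u v)"
  using inner_stack[of u v u v] by (simp add: norm_eq_sqrt_inner real_sqrt_le_mono)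

definition block_mat :: "'a^'p^'p \<Rightarrow> 'a^'d^'p \<Rightarrow> 'a^'p^'d \<Rightarrow> 'a^'d^'d \<Rightarrow> 'a^('p + 'd)^('p + 'd)" where
  "block_mat A B C D = (\<chi> k l. case k of
      Inl i \<Rightarrow> (case l of Inl i' \<Rightarrow> A $ i $ i' | Inr j' \<Rightarrow> B $ i $ j')
    | Inr j \<Rightarrow> (case l of Inl i' \<Rightarrow> C $ j $ i' | Inr j' \<Rightarrow> D $ j $ j'))"

lemma block_mat_nth [simp]:
  "block_mat A B C D $ Inl i $ Inl i' = A $ i $ i'" "block_mat A B C D $ Inl i $ Inr j' = B $ i $ j'"
  "block_mat A B C D $ Inr j $ Inl i' = C $ j $ i'" "block_mat A B C D $ Inr j $ Inr j' = D $ j $ j'"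
  by (simp_all add: block_mat_def)

lemma block_mat_mult_stack:
  fixes A :: "real^'p::finite^'p" and D :: "real^'d::finite^'d"
  shows "block_mat A B C D *v stack x y = stack (A *v x + B *v y) (C *v x + D *v y)"
  by (simp add: stack_eq_iff matrix_vector_mult_def sum_UNIV_Plus)

lemma covmat_stack:
  "covmat M (\<lambda>\<omega>. stack (U \<omega>) (V \<omega>)) (\<lambda>\<omega>. stack (U \<omega>) (V \<omega>))
     = block_mat (covmat M U U) (covmat M U V) (covmat M V U) (covmat M V V)"
  by (simp add: vec_eq_iff covmat_def block_mat_def split: sum.split)

lemma pos_def_block_mat_upper:
  fixes A :: "real^'p::finite^'p" and D :: "real^'d::finite^'d"
  assumes "pos_def_mat (block_mat A B C D)"
  shows "pos_def_mat A"
  unfolding pos_def_mat_def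
proof (intro conjI allI impI)
  have "transpose (block_mat A B C D) $ Inl i $ Inl i' = block_mat A B C D $ Inl i $ Inl i'" for i i'
    using assms unfolding pos_def_mat_def by simp
  then show "transpose A = A" by (simp add: vec_eq_iff transpose_def)
  fix u :: "real^'p" assume "u \<noteq> 0"
  then have "stack u 0 \<noteq> 0" by (metis stack_nth(1) vec_eq_iff zero_index)
  then have "0 < stack u 0 \<bullet> (block_mat A B C D *v stack u 0)"
    using assms unfolding pos_def_mat_def by blast
  then show "0 < u \<bullet> (A *v u)" by (simp add: block_mat_mult_stack inner_stack)
qed

lemma matrix_mul_diff_distrib: "(A::'a::ring_1^'n^'m) ** (B - C) = A ** B - A ** C"
  using matrix_add_ldistrib[of A "B - C" C] by (simp add: eq_diff_eq)

lemma matrix_mul_uminus_left: "(- A) ** (B::'a::ring_1^'n^'m) = - (A ** B)"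
  by (simp add: vec_eq_iff matrix_matrix_mult_def sum_negf)

text \<open>Read off the lower block row of \<open>Q [A B; C D] = 1\<close> and eliminate the lower left block of \<open>Q\<close>.\<close>
lemma matrix_inv_schur_complement:
  fixes A :: "real^'p::finite^'p" and B :: "real^'d::finite^'p" and C :: "real^'p^'d" and D :: "real^'d^'d"
  assumes "invertible (block_mat A B C D)" "invertible A"
  shows "matrix_inv (D - C ** matrix_inv A ** B) = (\<chi> j j'. matrix_inv (block_mat A B C D) $ Inr j $ Inr j')"
proof -
  define Q where "Q = matrix_inv (block_mat A B C D)"
  define QXZ :: "real^'p^'d" where "QXZ = (\<chi> j i. Q $ Inr j $ Inl i)"
  define QXX :: "real^'d^'d" where "QXX = (\<chi> j j'. Q $ Inr j $ Inr j')"
  have QS: "Q ** block_mat A B C D = mat 1" unfolding Q_def by (rule matrix_inv_left[OF assms(1)])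
  have "(QXZ ** A + QXX ** C) $ j $ i = (Q ** block_mat A B C D) $ Inr j $ Inl i"
    and "(QXZ ** B + QXX ** D) $ j $ j' = (Q ** block_mat A B C D) $ Inr j $ Inr j'" for j i j'
    by (simp_all add: matrix_matrix_mult_def sum_UNIV_Plus QXZ_def QXX_def)
  then have lower_left: "QXZ ** A + QXX ** C = 0" and lower_right: "QXZ ** B + QXX ** D = mat 1"
    unfolding QS by (simp_all add: vec_eq_iff mat_def)
  have "QXZ = (QXZ ** A) ** matrix_inv A"
    using matrix_inv_right[OF assms(2)] by (metis matrix_mul_assoc matrix_mul_rid)
  also have "QXZ ** A = - (QXX ** C)" using lower_left by (simp add: eq_neg_iff_add_eq_0)
  finally have "QXZ = - (QXX ** C ** matrix_inv A)"
    by (simp add: matrix_mul_uminus_left)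
  then have "QXX ** (C ** matrix_inv A ** B) = - (QXZ ** B)"
    by (simp add: matrix_mul_uminus_left matrix_mul_assoc)
  then have "QXX ** (D - C ** matrix_inv A ** B) = QXX ** D + QXZ ** B"
    by (simp add: matrix_mul_diff_distrib)
  also have "\<dots> = mat 1" using lower_right by (simp add: add.commute)
  finally show ?thesis unfolding Q_def[symmetric] QXX_def[symmetric] by (rule matrix_inv_eq_left)
qed

lemma diag_mult_vec: "(\<chi> j j'. if j = j' then a j else 0) *v v = (\<chi> j. a j * v $ j)"
proof -
  have "(\<Sum>j'\<in>UNIV. (if j = j' then a j else 0) * v $ j') = a j * v $ j" for j
    by (subst sum.remove[of _ j]) auto
  then show ?thesis by (simp add: vec_eq_iff matrix_vector_mult_def)
qed

lemma diag_on_Inr_mult_stack: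
  "diag_on (range Inr) (case_sum (\<lambda>_. 0) a) *v stack u v = stack 0 (\<chi> j. a j * v $ j)"
proof -
  have "(\<Sum>m\<in>UNIV. (if k = m \<and> k \<in> range Inr then case_sum (\<lambda>_. 0) a k else 0) * stack u v $ m)
      = (if k \<in> range Inr then case_sum (\<lambda>_. 0) a k * stack u v $ k else 0)" for k :: "'a + 'b"
    by (subst sum.remove[of _ k]) auto
  then show ?thesis
    by (auto simp: stack_eq_iff matrix_vector_mult_def diag_on_def)
qed

lemma matrix_vector_mult_stack_zero_Inr:
  "(Q *v stack 0 w) $ Inr j = ((\<chi> j j'. Q $ Inr j $ Inr j') *v w) $ j"
  by (simp add: matrix_vector_mult_def sum_UNIV_Plus)

section \<open>Consistency of solutions of perturbed linear systems\<close>

lemma onorm_matrix_le_norm: "onorm ((*v) (A::real^'n^'m)) \<le> real CARD('m) * real CARD('n) * norm A"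
  by (rule onorm_le_matrix_component)
    (meson component_le_norm_cart Finite_Cartesian_Product.norm_nth_le order_trans)

lemma norm_matrix_vector_le:
  fixes A :: "real^'n^'m"
  shows "norm (A *v x) \<le> onorm ((*v) A) * norm x"
  by (rule onorm[OF matrix_vector_mul_bounded_linear])

lemma linear_solution_perturbation:
  fixes S S' :: "real^'n^'n"
  assumes "invertible S" "S' *v b' = c'"
    and small: "onorm ((*v) (matrix_inv S)) * onorm ((*v) (S' - S)) \<le> 1/2"
  shows "norm (b' - matrix_inv S *v c)
    \<le> 2 * onorm ((*v) (matrix_inv S)) * (norm (c' - c) + onorm ((*v) (S' - S)) * norm (matrix_inv S *v c))"
proof -
  define \<kappa> where "\<kappa> = onorm ((*v) (matrix_inv S))"
  define \<delta> where "\<delta> = onorm ((*v) (S' - S))"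
  define b where "b = matrix_inv S *v c"
  have "0 \<le> \<kappa>" "0 \<le> \<delta>"
    unfolding \<kappa>_def \<delta>_def by (simp_all add: onorm_pos_le matrix_vector_mul_bounded_linear)
  have "S *v b = c"
    unfolding b_def by (simp add: matrix_vector_mul_assoc matrix_inv_right[OF assms(1)])
  then have "S *v (b' - b) = (c' - c) - (S' - S) *v b - (S' - S) *v (b' - b)"
    using assms(2) by (simp add: matrix_vector_mult_diff_distrib matrix_vector_mult_diff_rdistrib)
  then have "b' - b = matrix_inv S *v ((c' - c) - (S' - S) *v b - (S' - S) *v (b' - b))"
    by (metis matrix_inv_left[OF assms(1)] matrix_vector_mul_assoc matrix_vector_mul_lid)
  then have "norm (b' - b) \<le> \<kappa> * norm ((c' - c) - (S' - S) *v b - (S' - S) *v (b' - b))"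
    unfolding \<kappa>_def by (metis norm_matrix_vector_le)
  also have "\<dots> \<le> \<kappa> * (norm (c' - c) + \<delta> * norm b + \<delta> * norm (b' - b))"
  proof (rule mult_left_mono[OF _ \<open>0 \<le> \<kappa>\<close>])
    show "norm ((c' - c) - (S' - S) *v b - (S' - S) *v (b' - b)) \<le> norm (c' - c) + \<delta> * norm b + \<delta> * norm (b' - b)"
      using norm_triangle_ineq4[of "(c' - c) - (S' - S) *v b" "(S' - S) *v (b' - b)"]
        norm_triangle_ineq4[of "c' - c" "(S' - S) *v b"]
        norm_matrix_vector_le[of "S' - S" b] norm_matrix_vector_le[of "S' - S" "b' - b"]
      unfolding \<delta>_def by linarith
  qed
  also have "\<dots> \<le> \<kappa> * (norm (c' - c) + \<delta> * norm b) + norm (b' - b) / 2"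
    using small mult_right_mono[OF small, of "norm (b' - b)"] unfolding \<kappa>_def[symmetric] \<delta>_def[symmetric]
    by (simp add: algebra_simps)
  finally show ?thesis unfolding \<kappa>_def \<delta>_def b_def by simp
qed

lemma linear_solution_continuous:
  fixes S :: "real^'n^'n"
  assumes "invertible S" "0 < e"
  shows "\<exists>d>0. \<forall>S' c' b'. S' *v b' = c' \<longrightarrow> dist (S', c') (S, c) < d \<longrightarrow> dist b' (matrix_inv S *v c) \<le> e"
proof -
  define \<kappa> where "\<kappa> = onorm ((*v) (matrix_inv S))"
  define K where "K = real CARD('n) * real CARD('n)"
  define b where "b = matrix_inv S *v c"
  define C where "C = 2 * (\<kappa> + 1) * (K + 1) * (1 + norm b)"
  have "0 \<le> \<kappa>" unfolding \<kappa>_def by (simp add: onorm_pos_le)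
  have "0 \<le> K" unfolding K_def by simp
  have "1 * 1 * 1 \<le> (\<kappa> + 1) * (K + 1) * (1 + norm b)"
    using \<open>0 \<le> \<kappa>\<close> \<open>0 \<le> K\<close> by (intro mult_mono) auto
  then have "1 \<le> C" unfolding C_def by linarith
  define d where "d = min 1 e / C"
  have "0 < d" unfolding d_def using \<open>0 < e\<close> \<open>1 \<le> C\<close> by (intro divide_pos_pos) auto
  have "C \<noteq> 0" using \<open>1 \<le> C\<close> by auto
  then have Cd: "C * d = min 1 e" unfolding d_def by simp
  have bound: "dist b' b \<le> e" if solves: "S' *v b' = c'" and close: "dist (S', c') (S, c) < d" for S' c' b'
  proof -
    define \<delta> where "\<delta> = onorm ((*v) (S' - S))"
    have "0 \<le> \<delta>" unfolding \<delta>_def by (simp add: onorm_pos_le)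
    have "norm (S' - S) < d" "norm (c' - c) < d"
      using close dist_fst_le[of "(S', c')" "(S, c)"] dist_snd_le[of "(S', c')" "(S, c)"]
      by (simp_all add: dist_norm)
    then have "\<delta> \<le> K * d"
      using onorm_matrix_le_norm[of "S' - S"] mult_left_mono[of "norm (S' - S)" d K] \<open>0 \<le> K\<close>
      unfolding \<delta>_def K_def by linarith
    have "0 \<le> norm b * d" "0 \<le> K * d" using \<open>0 \<le> K\<close> \<open>0 < d\<close> by simp_all
    have expand: "C * d = 2 * (\<kappa> + 1) * ((d + K * d * norm b) + (norm b * d + K * d))"
      unfolding C_def by (simp add: algebra_simps)
    have "\<kappa> * \<delta> \<le> (\<kappa> + 1) * (K * d)"
      using \<open>\<delta> \<le> K * d\<close> \<open>0 \<le> \<kappa>\<close> \<open>0 \<le> \<delta>\<close> by (intro mult_mono) auto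
    also have "\<dots> \<le> (\<kappa> + 1) * ((d + K * d * norm b) + (norm b * d + K * d))"
      using \<open>0 \<le> \<kappa>\<close> \<open>0 < d\<close> \<open>0 \<le> norm b * d\<close> \<open>0 \<le> K * d\<close> \<open>0 \<le> K\<close>
      by (intro mult_left_mono) (auto intro: add_nonneg_nonneg mult_nonneg_nonneg)
    also have "\<dots> = C * d / 2" unfolding expand by simp
    also have "\<dots> \<le> 1/2" using Cd min.cobounded1[of 1 e] by simp
    finally have "\<kappa> * \<delta> \<le> 1/2" .
    then have "norm (b' - b) \<le> 2 * \<kappa> * (norm (c' - c) + \<delta> * norm b)"
      unfolding \<kappa>_def \<delta>_def b_def by (intro linear_solution_perturbation \<open>invertible S\<close> solves)
    also have "\<dots> \<le> 2 * (\<kappa> + 1) * (d + K * d * norm b)"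
      using \<open>norm (c' - c) < d\<close> \<open>\<delta> \<le> K * d\<close> \<open>0 \<le> \<kappa>\<close> \<open>0 \<le> \<delta>\<close>
      by (intro mult_mono add_mono mult_right_mono) auto
    also have "\<dots> \<le> C * d"
      unfolding expand using \<open>0 \<le> \<kappa>\<close> \<open>0 \<le> norm b * d\<close> \<open>0 \<le> K * d\<close>
      by (intro mult_left_mono) auto
    also have "\<dots> \<le> e" using Cd min.cobounded2[of 1 e] by simp
    finally show ?thesis by (simp add: dist_norm)
  qed
  show ?thesis
    using \<open>0 < d\<close> bound unfolding b_def by blast
qed

lemma conv_in_prob_linear_solution:
  fixes Sn :: "nat \<Rightarrow> 'a \<Rightarrow> real^'n^'n" and cn bn :: "nat \<Rightarrow> 'a \<Rightarrow> real^'n"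
  assumes conv: "conv_in_prob M (\<lambda>n \<omega>. (Sn n \<omega>, cn n \<omega>)) (S, c)" and "invertible S"
    and solves: "\<And>n \<omega>. 0 < n \<Longrightarrow> Sn n \<omega> *v bn n \<omega> = cn n \<omega>"
  shows "conv_in_prob M bn (matrix_inv S *v c)"
proof (rule conv_in_prob_transform[OF conv])
  fix e :: real assume "0 < e"
  obtain d where "0 < d"
    and "\<forall>S' c' b'. S' *v b' = c' \<longrightarrow> dist (S', c') (S, c) < d \<longrightarrow> dist b' (matrix_inv S *v c) \<le> e"
    using linear_solution_continuous[OF \<open>invertible S\<close> \<open>0 < e\<close>, of c] by blast
  with solves show "\<exists>d>0. \<forall>n>0. \<forall>\<omega>\<in>space M. dist (Sn n \<omega>, cn n \<omega>) (S, c) < d \<longrightarrow> dist (bn n \<omega>) (matrix_inv S *v c) \<le> e"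
    by blast
qed

lemma conv_in_prob_stack_Inr:
  assumes "conv_in_prob M (\<lambda>n \<omega>. stack (U n \<omega>) (V n \<omega>)) L"
  shows "conv_in_prob M V (\<chi> j. L $ Inr j)"
proof (rule conv_in_prob_transform[OF assms])
  fix e :: real assume "0 < e"
  obtain u v where L: "L = stack u v"
    using stack_eq_iff[of L "\<chi> i. L $ Inl i" "\<chi> j. L $ Inr j"] by auto
  have "dist (V n \<omega>) v \<le> dist (stack (U n \<omega>) (V n \<omega>)) L" for n \<omega>
    using norm_le_norm_stack[of "V n \<omega> - v" "U n \<omega> - u"] by (simp add: L dist_norm stack_diff)
  then show "\<exists>d>0. \<forall>n>0. \<forall>\<omega>\<in>space M. dist (stack (U n \<omega>) (V n \<omega>)) L < d \<longrightarrow> dist (V n \<omega>) (\<chi> j. L $ Inr j) \<le> e"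
    using \<open>0 < e\<close> unfolding L by (simp add: vec_lambda_eta) (meson less_imp_le order_trans)
qed

section \<open>Partial correlations and the precision matrix\<close>

locale L2_random_vector = prob_space +
  fixes V :: "'a \<Rightarrow> real^'k::finite"
  assumes L2_nth: "\<And>k. (\<lambda>\<omega>. V \<omega> $ k) \<in> L2 M"
begin

abbreviation Cov :: "real^'k^'k" where "Cov \<equiv> covmat M V V"

definition mean :: "'k \<Rightarrow> real" where "mean k = (\<integral>\<omega>. V \<omega> $ k \<partial>M)"

lemma L2_affine_V: "(\<lambda>\<omega>. c + (\<Sum>k\<in>S. b k * V \<omega> $ k)) \<in> L2 M"
  by (rule L2_affine) (rule L2_nth)

lemma cov_affine_V:
  "cov M (\<lambda>\<omega>. c + (\<Sum>k\<in>S. b k * V \<omega> $ k)) (\<lambda>\<omega>. c' + (\<Sum>l\<in>T. b' l * V \<omega> $ l))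
     = (\<Sum>k\<in>S. \<Sum>l\<in>T. b k * b' l * Cov $ k $ l)"
  by (simp add: cov_affine_left[OF L2_nth L2_affine_V] cov_affine_right[OF L2_nth L2_nth]
      covmat_def sum_distrib_left mult.assoc)

lemma integral_affine_V: "(\<integral>\<omega>. c + (\<Sum>k\<in>S. b k * V \<omega> $ k) \<partial>M) = c + (\<Sum>k\<in>S. b k * mean k)"
  using L2_integrable[OF L2_nth] by (simp add: integral_sum mean_def prob_space)

lemma quadratic_form_restrict:
  "(\<Sum>k\<in>R. \<Sum>l\<in>R. b k * b l * Cov $ k $ l) = x \<bullet> (Cov *v x)" if "x = (\<chi> k. if k \<in> R then b k else 0)"
proof -
  have restrict: "(\<Sum>k\<in>UNIV. if k \<in> B then g k else 0) = (sum g B :: real)" for B and g :: "'k \<Rightarrow> real"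
    by (simp add: sum.inter_restrict[symmetric])
  have "x \<bullet> (Cov *v x) = (\<Sum>k\<in>UNIV. \<Sum>l\<in>UNIV. x $ k * Cov $ k $ l * x $ l)"
    by (simp add: inner_vec_def matrix_vector_mult_def sum_distrib_left mult.assoc)
  also have "\<dots> = (\<Sum>k\<in>UNIV. if k \<in> R then (\<Sum>l\<in>UNIV. if l \<in> R then b k * b l * Cov $ k $ l else 0) else 0)"
    unfolding that by (intro sum.cong refl) (auto simp: algebra_simps intro!: sum.cong)
  also have "\<dots> = (\<Sum>k\<in>R. \<Sum>l\<in>R. b k * b l * Cov $ k $ l)"
    by (simp only: restrict)
  finally show ?thesis by simp
qed

lemma regression_risk_decomposition:
  assumes mean0: "(\<integral>\<omega>. V \<omega> $ i - c - (\<Sum>k\<in>R. b k * V \<omega> $ k) \<partial>M) = 0"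
    and orth: "\<And>l. l \<in> R \<Longrightarrow> cov M (\<lambda>\<omega>. V \<omega> $ i - c - (\<Sum>k\<in>R. b k * V \<omega> $ k)) (\<lambda>\<omega>. V \<omega> $ l) = 0"
  shows "(\<integral>\<omega>. (V \<omega> $ i - c' - (\<Sum>k\<in>R. b' k * V \<omega> $ k))\<^sup>2 \<partial>M)
    = (\<integral>\<omega>. (V \<omega> $ i - c - (\<Sum>k\<in>R. b k * V \<omega> $ k))\<^sup>2 \<partial>M)
      + (\<Sum>k\<in>R. \<Sum>l\<in>R. (b k - b' k) * (b l - b' l) * Cov $ k $ l)
      + (c - c' + (\<Sum>k\<in>R. (b k - b' k) * mean k))\<^sup>2"
proof -
  define \<rho> where "\<rho> = (\<lambda>\<omega>. V \<omega> $ i - c - (\<Sum>k\<in>R. b k * V \<omega> $ k))"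
  define L where "L \<omega> = (c - c') + (\<Sum>k\<in>R. (b k - b' k) * V \<omega> $ k)" for \<omega>
  have mean0': "(\<integral>\<omega>. \<rho> \<omega> \<partial>M) = 0" using mean0 unfolding \<rho>_def .
  have orth': "\<And>l. l \<in> R \<Longrightarrow> cov M \<rho> (\<lambda>\<omega>. V \<omega> $ l) = 0" using orth unfolding \<rho>_def .
  have L\<rho>: "\<rho> \<in> L2 M" unfolding \<rho>_def by (intro L2_diff L2_nth L2_affine_V L2_const L2_sum L2_scale)
  have LL: "L \<in> L2 M" unfolding L_def by (rule L2_affine_V)
  have "(\<integral>\<omega>. (V \<omega> $ i - c' - (\<Sum>k\<in>R. b' k * V \<omega> $ k))\<^sup>2 \<partial>M) = (\<integral>\<omega>. (\<rho> \<omega> + L \<omega>)\<^sup>2 \<partial>M)"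
    unfolding \<rho>_def L_def by (simp add: algebra_simps sum_subtractf left_diff_distrib)
  also have "\<dots> = cov M \<rho> \<rho> + 2 * cov M \<rho> L + cov M L L + (\<integral>\<omega>. L \<omega> \<partial>M)\<^sup>2"
    using L\<rho> LL mean0'
    by (simp add: integral_square_eq_cov cov_add_left cov_add_right L2_add cov_sym[of M L \<rho>]
        L2_integrable)
  also have "cov M \<rho> L = 0"
    unfolding L_def by (auto simp: cov_affine_right[OF L2_nth L\<rho>] orth' intro!: sum.neutral)
  also have "cov M L L = (\<Sum>k\<in>R. \<Sum>l\<in>R. (b k - b' k) * (b l - b' l) * Cov $ k $ l)"
    unfolding L_def by (rule cov_affine_V)
  also have "(\<integral>\<omega>. L \<omega> \<partial>M) = c - c' + (\<Sum>k\<in>R. (b k - b' k) * mean k)"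
    unfolding L_def by (rule integral_affine_V)
  also have "cov M \<rho> \<rho> = (\<integral>\<omega>. (\<rho> \<omega>)\<^sup>2 \<partial>M)"
    unfolding integral_square_eq_cov mean0' by simp
  finally show ?thesis unfolding \<rho>_def by simp
qed

lemma lin_resid_eq:
  assumes pd: "pos_def_mat Cov"
    and mean0: "(\<integral>\<omega>. V \<omega> $ i - c - (\<Sum>k\<in>R. b k * V \<omega> $ k) \<partial>M) = 0"
    and orth: "\<And>l. l \<in> R \<Longrightarrow> cov M (\<lambda>\<omega>. V \<omega> $ i - c - (\<Sum>k\<in>R. b k * V \<omega> $ k)) (\<lambda>\<omega>. V \<omega> $ l) = 0"
  shows "lin_resid M (\<lambda>\<omega>. V \<omega> $ i) V R = (\<lambda>\<omega>. V \<omega> $ i - c - (\<Sum>k\<in>R. b k * V \<omega> $ k))"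
proof -
  define Q where "Q c' b' = (\<integral>\<omega>. (V \<omega> $ i - c' - (\<Sum>k\<in>R. b' k * V \<omega> $ k))\<^sup>2 \<partial>M)" for c' b'
  define q where "q b' = (\<Sum>k\<in>R. \<Sum>l\<in>R. (b k - b' k) * (b l - b' l) * Cov $ k $ l)" for b'
  have decomp: "Q c' b' = Q c b + q b' + (c - c' + (\<Sum>k\<in>R. (b k - b' k) * mean k))\<^sup>2" for c' b'
    unfolding Q_def q_def by (rule regression_risk_decomposition[OF mean0 orth])
  have q_nonneg: "0 \<le> q b'" for b'
    unfolding q_def by (subst quadratic_form_restrict[OF refl]) (rule pos_def_mat_nonneg[OF pd])
  define cb where "cb = (SOME cb :: real \<times> ('k \<Rightarrow> real). \<forall>c' b'. Q (fst cb) (snd cb) \<le> Q c' b')"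
  have "Q c b \<le> Q c' b'" for c' b'
    using decomp[of c' b'] q_nonneg[of b']
      zero_le_power2[of "c - c' + (\<Sum>k\<in>R. (b k - b' k) * mean k)"] by linarith
  then have "\<exists>cb :: real \<times> ('k \<Rightarrow> real). \<forall>c' b'. Q (fst cb) (snd cb) \<le> Q c' b'"
    by (intro exI[of _ "(c, b)"]) simp
  then have "\<forall>c' b'. Q (fst cb) (snd cb) \<le> Q c' b'"
    unfolding cb_def by (rule someI_ex)
  then have "Q (fst cb) (snd cb) \<le> Q c b" by blast
  then have q0: "q (snd cb) = 0" and c_eq: "(c - fst cb + (\<Sum>k\<in>R. (b k - snd cb k) * mean k))\<^sup>2 = 0"
    using decomp[of "fst cb" "snd cb"] q_nonneg[of "snd cb"]
      zero_le_power2[of "c - fst cb + (\<Sum>k\<in>R. (b k - snd cb k) * mean k)"] by linarith+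
  define x where "x = (\<chi> k. if k \<in> R then b k - snd cb k else 0)"
  have "x \<bullet> (Cov *v x) = 0"
    using q0 quadratic_form_restrict[OF x_def] unfolding q_def by simp
  have "x = 0"
  proof (rule ccontr)
    assume "x \<noteq> 0"
    then have "0 < x \<bullet> (Cov *v x)" using pd unfolding pos_def_mat_def by blast
    with \<open>x \<bullet> (Cov *v x) = 0\<close> show False by simp
  qed
  then have b_eq: "k \<in> R \<Longrightarrow> snd cb k = b k" for k
    unfolding x_def by (auto simp: vec_eq_iff split: if_splits)
  then have "fst cb = c" using c_eq by simp
  have "lin_resid M (\<lambda>\<omega>. V \<omega> $ i) V R = (\<lambda>\<omega>. V \<omega> $ i - fst cb - (\<Sum>k\<in>R. snd cb k * V \<omega> $ k))"
    unfolding lin_resid_def Let_def cb_def Q_def by (rule refl)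
  moreover have "(\<Sum>k\<in>R. snd cb k * V \<omega> $ k) = (\<Sum>k\<in>R. b k * V \<omega> $ k)" for \<omega>
    using b_eq by (intro sum.cong) auto
  ultimately show ?thesis using \<open>fst cb = c\<close> by simp
qed

definition centred_form :: "real^'k \<Rightarrow> 'a \<Rightarrow> real" where
  "centred_form w \<omega> = (\<Sum>k\<in>UNIV. w $ k * (V \<omega> $ k - mean k))"

lemma centred_form_affine:
  "centred_form w = (\<lambda>\<omega>. - (\<Sum>k\<in>UNIV. w $ k * mean k) + (\<Sum>k\<in>UNIV. w $ k * V \<omega> $ k))"
  by (auto simp: centred_form_def algebra_simps sum_subtractf)

lemma integral_centred_form: "(\<integral>\<omega>. centred_form w \<omega> \<partial>M) = 0"
  unfolding centred_form_affine integral_affine_V by simp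

lemma cov_centred_form: "cov M (centred_form w) (centred_form w') = w \<bullet> (Cov *v w')"
  unfolding centred_form_affine cov_affine_V
  by (simp add: inner_vec_def matrix_vector_mult_def sum_distrib_left algebra_simps)

lemma cov_centred_form_nth: "cov M (centred_form w) (\<lambda>\<omega>. V \<omega> $ l) = (Cov *v w) $ l"
  unfolding centred_form_affine
  by (subst cov_affine_left[OF L2_nth L2_nth]) (simp add: matrix_vector_mult_def covmat_def cov_sym mult.commute)

lemma lin_resid_centred_form:
  assumes pd: "pos_def_mat Cov" and "i \<noteq> j" "w $ i = 1" "w $ j = 0"
    and orth: "\<And>l. l \<notin> {i, j} \<Longrightarrow> (Cov *v w) $ l = 0"
  shows "lin_resid M (\<lambda>\<omega>. V \<omega> $ i) V (UNIV - {i, j}) = centred_form w"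
proof -
  have split: "(\<Sum>k\<in>UNIV. f k) = f i + f j + (\<Sum>k\<in>UNIV - {i, j}. f k)" for f :: "'k \<Rightarrow> real"
    using \<open>i \<noteq> j\<close> by (subst sum.subset_diff[of "{i, j}"]) auto
  have "centred_form w \<omega> = V \<omega> $ i - (\<Sum>k\<in>UNIV. w $ k * mean k)
      - (\<Sum>k\<in>UNIV - {i, j}. (- w $ k) * V \<omega> $ k)" for \<omega>
    unfolding centred_form_affine using assms(3,4)
    by (simp add: split[of "\<lambda>k. w $ k * V \<omega> $ k"] sum_negf)
  then have form: "centred_form w = (\<lambda>\<omega>. V \<omega> $ i - (\<Sum>k\<in>UNIV. w $ k * mean k)
      - (\<Sum>k\<in>UNIV - {i, j}. (- w $ k) * V \<omega> $ k))"
    by blast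
  show ?thesis
    unfolding form
    by (rule lin_resid_eq[OF pd])
      (unfold form[symmetric], simp_all add: integral_centred_form cov_centred_form_nth orth)
qed

text \<open>The two residuals are the centred linear forms with coefficient vectors proportional to
  \<open>P\<^sub>j\<^sub>j P e\<^sub>i - P\<^sub>i\<^sub>j P e\<^sub>j\<close> and \<open>P\<^sub>i\<^sub>i P e\<^sub>j - P\<^sub>i\<^sub>j P e\<^sub>i\<close>.\<close>
theorem partial_corr_eq_precision:
  assumes pd: "pos_def_mat Cov" and "i \<noteq> j"
  defines "P \<equiv> matrix_inv Cov"
  shows "partial_corr M V i j = - P $ i $ j / sqrt (P $ i $ i * P $ j $ j)"
proof -
  have inv: "invertible Cov" by (rule pos_def_mat_invertible[OF pd])
  have sym: "P $ k $ l = P $ l $ k" for k l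
    unfolding P_def using pd inv by (simp add: pos_def_mat_def symmetric_matrix_inv)
  define col where "col k = P *v axis k 1" for k
  have col_nth: "col k $ l = P $ l $ k" for k l
    unfolding col_def by (simp add: matrix_vector_mult_def axis_def if_distrib if_distribR cong: if_cong)
  have Cov_col: "Cov *v col k = axis k 1" for k
    unfolding col_def P_def using matrix_inv_right[OF inv] by (simp add: matrix_vector_mul_assoc)
  define dt where "dt = P $ i $ i * P $ j $ j - P $ i $ j * P $ i $ j"
  define vi where "vi = P $ j $ j *\<^sub>R col i - P $ i $ j *\<^sub>R col j"
  define vj where "vj = P $ i $ i *\<^sub>R col j - P $ i $ j *\<^sub>R col i"
  have Cov_vi: "Cov *v vi = P $ j $ j *\<^sub>R axis i 1 - P $ i $ j *\<^sub>R axis j 1"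
    and Cov_vj: "Cov *v vj = P $ i $ i *\<^sub>R axis j 1 - P $ i $ j *\<^sub>R axis i 1"
    unfolding vi_def vj_def by (simp_all add: matrix_vector_mult_diff_distrib matrix_vector_mult_scaleR Cov_col)
  have vi_nth: "vi $ i = dt" "vi $ j = 0" and vj_nth: "vj $ j = dt" "vj $ i = 0"
    unfolding vi_def vj_def dt_def using sym[of i j] by (auto simp: col_nth algebra_simps)
  have Pii: "0 < P $ i $ i" and Pjj: "0 < P $ j $ j"
    unfolding P_def by (simp_all add: pos_def_matrix_inv_diag_pos[OF pd])
  have quad_vi: "vi \<bullet> (Cov *v vi) = P $ j $ j * dt" and quad_vj: "vj \<bullet> (Cov *v vj) = P $ i $ i * dt"
    and cross: "vi \<bullet> (Cov *v vj) = - P $ i $ j * dt"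
    unfolding Cov_vi Cov_vj using \<open>i \<noteq> j\<close> vi_nth vj_nth by (simp_all add: inner_diff_right inner_axis)
  have "(Cov *v vi) $ i \<noteq> 0" using Cov_vi Pjj \<open>i \<noteq> j\<close> by (simp add: axis_def)
  then have "vi \<noteq> 0" by auto
  then have "0 < vi \<bullet> (Cov *v vi)" using pd unfolding pos_def_mat_def by blast
  then have "0 < P $ j $ j * dt" using quad_vi by simp
  then have "0 < dt" using Pjj by (simp add: zero_less_mult_iff)
  define wi where "wi = (1 / dt) *\<^sub>R vi"
  define wj where "wj = (1 / dt) *\<^sub>R vj"
  have ri: "lin_resid M (\<lambda>\<omega>. V \<omega> $ i) V (UNIV - {i, j}) = centred_form wi"
    using \<open>0 < dt\<close> \<open>i \<noteq> j\<close> vi_nth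
    by (intro lin_resid_centred_form[OF pd]) (auto simp: wi_def matrix_vector_mult_scaleR Cov_vi axis_def)
  have "lin_resid M (\<lambda>\<omega>. V \<omega> $ j) V (UNIV - {j, i}) = centred_form wj"
    using \<open>0 < dt\<close> \<open>i \<noteq> j\<close> vj_nth
    by (intro lin_resid_centred_form[OF pd]) (auto simp: wj_def matrix_vector_mult_scaleR Cov_vj axis_def)
  then have rj: "lin_resid M (\<lambda>\<omega>. V \<omega> $ j) V (UNIV - {i, j}) = centred_form wj"
    by (simp add: insert_commute)
  have "cov M (centred_form wi) (centred_form wj) = - P $ i $ j / dt"
    and "cov M (centred_form wi) (centred_form wi) = P $ j $ j / dt"
    and "cov M (centred_form wj) (centred_form wj) = P $ i $ i / dt"
    using \<open>0 < dt\<close> quad_vi quad_vj cross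
    by (simp_all add: cov_centred_form wi_def wj_def matrix_vector_mult_scaleR power2_eq_square field_simps)
  moreover have "sqrt (P $ j $ j / dt * (P $ i $ i / dt)) = sqrt (P $ i $ i * P $ j $ j) / dt"
    using \<open>0 < dt\<close> by (simp add: real_sqrt_divide real_sqrt_mult power2_eq_square[symmetric] mult.commute)
  ultimately show ?thesis
    using \<open>0 < dt\<close> unfolding partial_corr_def corr_def ri rj by simp
qed

corollary precision_neg_if_partial_corr_pos:
  assumes "pos_def_mat Cov" "i \<noteq> j" "0 < partial_corr M V i j"
  shows "matrix_inv Cov $ i $ j < 0"
proof -
  have "0 < sqrt (matrix_inv Cov $ i $ i * matrix_inv Cov $ j $ j)"
    using pos_def_matrix_inv_diag_pos[OF assms(1)] by simp
  then show ?thesis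
    using assms(3) unfolding partial_corr_eq_precision[OF assms(1,2)] by (simp add: divide_less_0_iff)
qed

end

section \<open>Sample covariances\<close>

lemma conv_in_prob_sample_cov:
  fixes T :: "nat \<Rightarrow> 'a \<Rightarrow> 'b" and Tpop :: "'a \<Rightarrow> 'b" and f g :: "'b \<Rightarrow> real"
  assumes "conv_in_prob M (\<lambda>N \<omega>. (\<Sum>i<N. f (T i \<omega>) * g (T i \<omega>)) / real N) (\<integral>\<omega>. f (Tpop \<omega>) * g (Tpop \<omega>) \<partial>M)"
    and "conv_in_prob M (\<lambda>N \<omega>. (\<Sum>i<N. f (T i \<omega>) * 1) / real N) (\<integral>\<omega>. f (Tpop \<omega>) * 1 \<partial>M)"
    and "conv_in_prob M (\<lambda>N \<omega>. (\<Sum>i<N. g (T i \<omega>) * 1) / real N) (\<integral>\<omega>. g (Tpop \<omega>) * 1 \<partial>M)"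
  shows "conv_in_prob M (\<lambda>N \<omega>. cov (uniform_count_measure {..<N}) (\<lambda>i. f (T i \<omega>)) (\<lambda>i. g (T i \<omega>)))
           (cov M (\<lambda>\<omega>. f (Tpop \<omega>)) (\<lambda>\<omega>. g (Tpop \<omega>)))"
proof -
  have "isCont (\<lambda>p::real \<times> real \<times> real. fst p - fst (snd p) * snd (snd p)) q" for q
    by (intro continuous_intros)
  from conv_in_prob_isCont[OF conv_in_prob_Pair[OF assms(1) conv_in_prob_Pair[OF assms(2,3)]] this]
  show ?thesis by (simp add: cov_def integral_uniform_count_measure)
qed

lemma conv_in_prob_sample_covmat:
  fixes T :: "nat \<Rightarrow> 'a \<Rightarrow> 'b" and Tpop :: "'a \<Rightarrow> 'b"
    and feat :: "'k::finite \<Rightarrow> 'b \<Rightarrow> real" and resp :: "'b \<Rightarrow> real"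
  assumes moments: "\<And>f g. f \<in> F \<Longrightarrow> g \<in> F \<Longrightarrow>
      conv_in_prob M (\<lambda>N \<omega>. (\<Sum>i<N. f (T i \<omega>) * g (T i \<omega>)) / real N) (\<integral>\<omega>. f (Tpop \<omega>) * g (Tpop \<omega>) \<partial>M)"
    and F: "(\<lambda>_. 1) \<in> F" "\<And>k. feat k \<in> F" "resp \<in> F"
  shows "conv_in_prob M
    (\<lambda>N \<omega>. (covmat (uniform_count_measure {..<N}) (\<lambda>i. \<chi> k. feat k (T i \<omega>)) (\<lambda>i. \<chi> k. feat k (T i \<omega>)),
             \<chi> k. cov (uniform_count_measure {..<N}) (\<lambda>i. feat k (T i \<omega>)) (\<lambda>i. resp (T i \<omega>))))
    (covmat M (\<lambda>\<omega>. \<chi> k. feat k (Tpop \<omega>)) (\<lambda>\<omega>. \<chi> k. feat k (Tpop \<omega>)),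
     \<chi> k. cov M (\<lambda>\<omega>. feat k (Tpop \<omega>)) (\<lambda>\<omega>. resp (Tpop \<omega>)))"
proof -
  have cov: "conv_in_prob M (\<lambda>N \<omega>. cov (uniform_count_measure {..<N}) (\<lambda>i. f (T i \<omega>)) (\<lambda>i. g (T i \<omega>)))
      (cov M (\<lambda>\<omega>. f (Tpop \<omega>)) (\<lambda>\<omega>. g (Tpop \<omega>)))" if "f \<in> F" "g \<in> F" for f g
    using moments[OF that] moments[OF that(1) F(1)] moments[OF that(2) F(1)]
    by (rule conv_in_prob_sample_cov)
  show ?thesis
    unfolding covmat_def
    by (intro conv_in_prob_Pair conv_in_prob_componentwise) (simp_all add: cov F)
qed

lemma conv_in_prob_ols:
  fixes Vs :: "nat \<Rightarrow> 'a \<Rightarrow> real^'k::finite" and Ys :: "nat \<Rightarrow> 'a \<Rightarrow> real"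
  assumes conv: "conv_in_prob M
      (\<lambda>N \<omega>. (covmat (uniform_count_measure {..<N}) (\<lambda>i. Vs i \<omega>) (\<lambda>i. Vs i \<omega>),
               \<chi> k. cov (uniform_count_measure {..<N}) (\<lambda>i. Vs i \<omega> $ k) (\<lambda>i. Ys i \<omega>))) (S, c)"
    and "invertible S"
    and ols: "\<And>N \<omega> c' b'. (\<Sum>i<N. (Ys i \<omega> - chat N \<omega> - Vs i \<omega> \<bullet> bhat N \<omega>)\<^sup>2) \<le> (\<Sum>i<N. (Ys i \<omega> - c' - Vs i \<omega> \<bullet> b')\<^sup>2)"
  shows "conv_in_prob M bhat (matrix_inv S *v c)"
  using conv \<open>invertible S\<close> by (rule conv_in_prob_linear_solution) (rule ols_normal_equations[OF _ ols])

lemma stack_coord_in_coords: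
  "(\<lambda>(y::real, z::real^'p::finite, x::real^'d::finite, w::real^'d). stack z w $ m) \<in> coords"
proof (cases m)
  case (Inl i)
  then have "(\<lambda>(y::real, z::real^'p, x::real^'d, w::real^'d). stack z w $ m) = (\<lambda>(y, z, x, w). z $ i)"
    by (auto simp: fun_eq_iff)
  then show ?thesis by (auto simp: coords_def)
next
  case (Inr j)
  then have "(\<lambda>(y::real, z::real^'p, x::real^'d, w::real^'d). stack z w $ m) = (\<lambda>(y, z, x, w). w $ j)"
    by (auto simp: fun_eq_iff)
  then show ?thesis by (auto simp: coords_def)
qed

section \<open>The classical uncorrelated measurement error model\<close>

locale cume_model = prob_space +
  fixes Y :: "'a \<Rightarrow> real" and Z :: "'a \<Rightarrow> real^'p::finite" and X W :: "'a \<Rightarrow> real^'d::finite"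
    and a :: "'d \<Rightarrow> real"
  assumes measurable: "(\<lambda>\<omega>. (Y \<omega>, Z \<omega>, X \<omega>, W \<omega>)) \<in> borel_measurable M"
    and square_integrable: "\<forall>f\<in>coords. integrable M (\<lambda>\<omega>. (f (Y \<omega>, Z \<omega>, X \<omega>, W \<omega>))\<^sup>2)"
    and indep_error: "indep_set (sets (vimage_algebra (space M) (\<lambda>\<omega>. W \<omega> - X \<omega>) borel))
        (sets (vimage_algebra (space M) (\<lambda>\<omega>. (Z \<omega>, X \<omega>, Y \<omega>)) borel))"
    and cov_error: "covmat M (\<lambda>\<omega>. W \<omega> - X \<omega>) (\<lambda>\<omega>. W \<omega> - X \<omega>) = (\<chi> j j'. if j = j' then a j else 0)"
begin

abbreviation ZX :: "'a \<Rightarrow> real^('p + 'd)" where "ZX \<equiv> \<lambda>\<omega>. stack (Z \<omega>) (X \<omega>)"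

abbreviation ZW :: "'a \<Rightarrow> real^('p + 'd)" where "ZW \<equiv> \<lambda>\<omega>. stack (Z \<omega>) (W \<omega>)"

lemma measurable_continuous_image:
  "continuous_on UNIV g \<Longrightarrow> (\<lambda>\<omega>. g (Y \<omega>, Z \<omega>, X \<omega>, W \<omega>)) \<in> borel_measurable M"
  by (rule measurable_compose[OF measurable borel_measurable_continuous_onI])

lemma L2_Y: "Y \<in> L2 M"
proof (rule L2I)
  show "Y \<in> borel_measurable M"
    using measurable_continuous_image[of fst] by (simp add: continuous_on_fst continuous_on_id)
  show "integrable M (\<lambda>\<omega>. (Y \<omega>)\<^sup>2)"
    using bspec[OF square_integrable, of "\<lambda>(y, z, x, w). y"] by (simp add: coords_def)
qed

lemma L2_Z: "(\<lambda>\<omega>. Z \<omega> $ k) \<in> L2 M"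
proof (rule L2I)
  show "(\<lambda>\<omega>. Z \<omega> $ k) \<in> borel_measurable M"
    using measurable_continuous_image[of "\<lambda>t. fst (snd t) $ k"] by (simp add: continuous_intros)
  show "integrable M (\<lambda>\<omega>. (Z \<omega> $ k)\<^sup>2)"
    using bspec[OF square_integrable, of "\<lambda>(y, z, x, w). z $ k"] by (auto simp: coords_def)
qed

lemma L2_X: "(\<lambda>\<omega>. X \<omega> $ k) \<in> L2 M"
proof (rule L2I)
  show "(\<lambda>\<omega>. X \<omega> $ k) \<in> borel_measurable M"
    using measurable_continuous_image[of "\<lambda>t. fst (snd (snd t)) $ k"] by (simp add: continuous_intros)
  show "integrable M (\<lambda>\<omega>. (X \<omega> $ k)\<^sup>2)"
    using bspec[OF square_integrable, of "\<lambda>(y, z, x, w). x $ k"] by (auto simp: coords_def)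
qed

lemma L2_W: "(\<lambda>\<omega>. W \<omega> $ k) \<in> L2 M"
proof (rule L2I)
  show "(\<lambda>\<omega>. W \<omega> $ k) \<in> borel_measurable M"
    using measurable_continuous_image[of "\<lambda>t. snd (snd (snd t)) $ k"] by (simp add: continuous_intros)
  show "integrable M (\<lambda>\<omega>. (W \<omega> $ k)\<^sup>2)"
    using bspec[OF square_integrable, of "\<lambda>(y, z, x, w). w $ k"] by (auto simp: coords_def)
qed

lemma L2_error: "(\<lambda>\<omega>. W \<omega> $ j - X \<omega> $ j) \<in> L2 M"
  by (rule L2_diff[OF L2_W L2_X])

lemma L2_stack_ZX: "(\<lambda>\<omega>. ZX \<omega> $ m) \<in> L2 M"
  by (cases m) (simp_all add: L2_Z L2_X)

lemma cov_error_indep: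
  fixes h :: "(real^'p) \<times> (real^'d) \<times> real \<Rightarrow> real"
  assumes "continuous_on UNIV h" "(\<lambda>\<omega>. h (Z \<omega>, X \<omega>, Y \<omega>)) \<in> L2 M"
  shows "cov M (\<lambda>\<omega>. W \<omega> $ j - X \<omega> $ j) (\<lambda>\<omega>. h (Z \<omega>, X \<omega>, Y \<omega>)) = 0"
proof -
  have "(\<lambda>\<omega>. W \<omega> - X \<omega>) \<in> borel_measurable M"
    using measurable_continuous_image[of "\<lambda>t. snd (snd (snd t)) - fst (snd (snd t))"]
    by (simp add: continuous_intros)
  moreover have "(\<lambda>\<omega>. (Z \<omega>, X \<omega>, Y \<omega>)) \<in> borel_measurable M"
    using measurable_continuous_image[of "\<lambda>t. (fst (snd t), fst (snd (snd t)), fst t)"]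
    by (simp add: continuous_intros)
  ultimately have "(\<integral>\<omega>. (W \<omega> - X \<omega>) $ j * h (Z \<omega>, X \<omega>, Y \<omega>) \<partial>M)
      = (\<integral>\<omega>. (W \<omega> - X \<omega>) $ j \<partial>M) * (\<integral>\<omega>. h (Z \<omega>, X \<omega>, Y \<omega>) \<partial>M)"
    using L2_integrable[OF L2_error] L2_integrable[OF assms(2)]
    by (intro indep_set_vimage_integral_mult[OF indep_error, where f="\<lambda>e. e $ j" and g=h])
      (auto intro!: borel_measurable_continuous_onI assms(1) continuous_intros)
  then show ?thesis unfolding cov_def by simp
qed

lemma cov_error_Z: "cov M (\<lambda>\<omega>. W \<omega> $ j - X \<omega> $ j) (\<lambda>\<omega>. Z \<omega> $ k) = 0"
  using cov_error_indep[of "\<lambda>t. fst t $ k" j] L2_Z[of k] by (simp add: continuous_intros)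

lemma cov_error_X: "cov M (\<lambda>\<omega>. W \<omega> $ j - X \<omega> $ j) (\<lambda>\<omega>. X \<omega> $ k) = 0"
  using cov_error_indep[of "\<lambda>t. fst (snd t) $ k" j] L2_X[of k] by (simp add: continuous_intros)

lemma cov_error_Y: "cov M (\<lambda>\<omega>. W \<omega> $ j - X \<omega> $ j) Y = 0"
  using cov_error_indep[of "\<lambda>t. snd (snd t)" j] L2_Y by (simp add: continuous_intros)

lemma cov_W_left:
  assumes "h \<in> L2 M"
  shows "cov M (\<lambda>\<omega>. W \<omega> $ j) h = cov M (\<lambda>\<omega>. X \<omega> $ j) h + cov M (\<lambda>\<omega>. W \<omega> $ j - X \<omega> $ j) h"
proof -
  have W_eq: "(\<lambda>\<omega>. W \<omega> $ j) = (\<lambda>\<omega>. X \<omega> $ j + (W \<omega> $ j - X \<omega> $ j))" by simp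
  show ?thesis unfolding W_eq by (rule cov_add_left[OF L2_X L2_error assms])
qed

lemma covmat_W_Z: "covmat M W Z = covmat M X Z"
  using cov_error_Z by (simp add: vec_eq_iff covmat_def cov_W_left[OF L2_Z])

lemma cov_W_W:
  "cov M (\<lambda>\<omega>. W \<omega> $ j) (\<lambda>\<omega>. W \<omega> $ j') = cov M (\<lambda>\<omega>. X \<omega> $ j) (\<lambda>\<omega>. X \<omega> $ j') + (if j = j' then a j else 0)"
proof -
  have error: "cov M (\<lambda>\<omega>. W \<omega> $ j - X \<omega> $ j) (\<lambda>\<omega>. W \<omega> $ j' - X \<omega> $ j') = (if j = j' then a j else 0)"
    using arg_cong[OF cov_error, of "\<lambda>m. m $ j $ j'"] by (simp add: covmat_def)
  have "cov M (\<lambda>\<omega>. W \<omega> $ j) (\<lambda>\<omega>. W \<omega> $ j')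
      = cov M (\<lambda>\<omega>. X \<omega> $ j) (\<lambda>\<omega>. W \<omega> $ j') + cov M (\<lambda>\<omega>. W \<omega> $ j - X \<omega> $ j) (\<lambda>\<omega>. W \<omega> $ j')"
    by (rule cov_W_left[OF L2_W])
  also have "cov M (\<lambda>\<omega>. X \<omega> $ j) (\<lambda>\<omega>. W \<omega> $ j') = cov M (\<lambda>\<omega>. X \<omega> $ j) (\<lambda>\<omega>. X \<omega> $ j')"
    using cov_W_left[OF L2_X, of j'] cov_error_X[of j' j] by (simp add: cov_sym)
  also have "cov M (\<lambda>\<omega>. W \<omega> $ j - X \<omega> $ j) (\<lambda>\<omega>. W \<omega> $ j') = (if j = j' then a j else 0)"
    using cov_W_left[OF L2_error, of j'] cov_error_X[of j j'] error by (simp add: cov_sym)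
  finally show ?thesis .
qed

lemma covmat_W_W: "covmat M W W = covmat M X X + (\<chi> j j'. if j = j' then a j else 0)"
  by (simp add: vec_eq_iff covmat_def cov_W_W)

lemma covmat_stack_ZW: "covmat M ZW ZW = covmat M ZX ZX + diag_on (range Inr) (case_sum (\<lambda>_. 0) a)"
proof -
  have "covmat M Z W = covmat M Z X"
    using covmat_W_Z by (metis covmat_transpose)
  then show ?thesis
    unfolding covmat_stack covmat_W_Z
    by (auto simp: vec_eq_iff block_mat_def diag_on_def covmat_def cov_W_W split: sum.split)
qed

lemma cov_stack_ZW_Y:
  "(\<chi> m. cov M (\<lambda>\<omega>. ZW \<omega> $ m) Y) = (\<chi> m. cov M (\<lambda>\<omega>. ZX \<omega> $ m) Y)"
proof (subst vec_eq_iff, intro allI)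
  fix m :: "'p + 'd"
  show "(\<chi> m. cov M (\<lambda>\<omega>. ZW \<omega> $ m) Y) $ m = (\<chi> m. cov M (\<lambda>\<omega>. ZX \<omega> $ m) Y) $ m"
    by (cases m) (simp_all add: cov_W_left[OF L2_Y] cov_error_Y)
qed

lemma population_normal_equations:
  assumes "\<forall>a' bZ bX. (\<integral>\<omega>. (1/2) * (Y \<omega> - \<alpha> - Z \<omega> \<bullet> \<beta>Z - X \<omega> \<bullet> \<beta>X)\<^sup>2 \<partial>M)
                     \<le> (\<integral>\<omega>. (1/2) * (Y \<omega> - a' - Z \<omega> \<bullet> bZ - X \<omega> \<bullet> bX)\<^sup>2 \<partial>M)"
  shows "covmat M ZX ZX *v stack \<beta>Z \<beta>X
    = (\<chi> m. cov M (\<lambda>\<omega>. ZX \<omega> $ m) Y)"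
proof (rule least_squares_normal_equations[OF L2_stack_ZX L2_Y, where c=\<alpha>])
  fix c' :: real and b' :: "real^('p + 'd)"
  have "b' = stack (\<chi> i. b' $ Inl i) (\<chi> j. b' $ Inr j)" by (simp add: stack_eq_iff)
  then have "stack (Z \<omega>) (X \<omega>) \<bullet> b' = Z \<omega> \<bullet> (\<chi> i. b' $ Inl i) + X \<omega> \<bullet> (\<chi> j. b' $ Inr j)" for \<omega>
    by (metis inner_stack)
  then show "(\<integral>\<omega>. (Y \<omega> - \<alpha> - stack (Z \<omega>) (X \<omega>) \<bullet> stack \<beta>Z \<beta>X)\<^sup>2 \<partial>M)
      \<le> (\<integral>\<omega>. (Y \<omega> - c' - stack (Z \<omega>) (X \<omega>) \<bullet> b')\<^sup>2 \<partial>M)"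
    using assms[rule_format, of c' "\<chi> i. b' $ Inl i" "\<chi> j. b' $ Inr j"]
    by (simp add: inner_stack diff_diff_eq add.assoc)
qed

lemma pos_def_covmat_ZW:
  "pos_def_mat (covmat M ZX ZX)
    \<Longrightarrow> \<forall>j. 0 \<le> a j \<Longrightarrow> pos_def_mat (covmat M ZW ZW)"
  unfolding covmat_stack_ZW by (rule pos_def_add_diag_on) (auto split: sum.split)

lemma nonpos_offdiag_inverse_covmat_ZW:
  assumes pd: "pos_def_mat (covmat M ZX ZX)"
    and a: "\<forall>j. 0 \<le> a j"
    and ppc: "\<forall>j j'. j \<noteq> j' \<longrightarrow> 0 < partial_corr M ZX (Inr j) (Inr j')"
  shows "nonpos_offdiag_on (range Inr) (matrix_inv (covmat M ZW ZW))"
proof -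
  interpret ZX_vector: L2_random_vector M ZX
    by unfold_locales (rule L2_stack_ZX)
  have "nonpos_offdiag_on (range Inr) (matrix_inv (covmat M ZX ZX))"
    using ZX_vector.precision_neg_if_partial_corr_pos[OF pd] ppc
    unfolding nonpos_offdiag_on_def by (auto intro: less_imp_le)
  then show ?thesis
    unfolding covmat_stack_ZW using a
    by (intro nonpos_offdiag_on_inverse_add_diag_on[OF pd]) (auto split: sum.split)
qed

lemma inverse_covmat_ZW_diag_le:
  assumes pd: "pos_def_mat (covmat M ZX ZX)"
    and a: "\<forall>j. 0 \<le> a j" and "0 < a j"
  shows "matrix_inv (covmat M ZW ZW) $ Inr j $ Inr j \<le> 1 / a j"
proof (rule pos_def_matrix_inv_diag_le[OF pos_def_covmat_ZW[OF pd a] _ \<open>0 < a j\<close>])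
  fix u :: "real^('p + 'd)"
  have "a j * (u $ Inr j)\<^sup>2 \<le> (\<Sum>k\<in>range Inr. case_sum (\<lambda>_. 0) a k * (u $ k)\<^sup>2)"
    using member_le_sum[of "Inr j" "range Inr" "\<lambda>k. case_sum (\<lambda>_. 0) a k * (u $ k)\<^sup>2"] a
    by (auto split: sum.split)
  then show "a j * (u $ Inr j)\<^sup>2 \<le> u \<bullet> (covmat M ZW ZW *v u)"
    using pos_def_mat_nonneg[OF pd, of u]
    by (simp add: covmat_stack_ZW matrix_vector_mult_add_rdistrib inner_add_right inner_diag_on)
qed

lemma ols_limit_eq:
  assumes pd: "pos_def_mat (covmat M ZW ZW)"
    and normal: "covmat M ZX ZX *v b = (\<chi> m. cov M (\<lambda>\<omega>. ZX \<omega> $ m) Y)"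
  defines "Q \<equiv> matrix_inv (covmat M ZW ZW)"
  shows "Q *v (\<chi> m. cov M (\<lambda>\<omega>. ZW \<omega> $ m) Y) = b - Q *v (diag_on (range Inr) (case_sum (\<lambda>_. 0) a) *v b)"
proof -
  have "Q ** covmat M ZW ZW = mat 1"
    unfolding Q_def by (rule matrix_inv_left[OF pos_def_mat_invertible[OF pd]])
  then have "(Q ** covmat M ZX ZX + Q ** diag_on (range Inr) (case_sum (\<lambda>_. 0) a)) *v b = b"
    unfolding covmat_stack_ZW matrix_add_ldistrib by simp
  then have "Q *v (covmat M ZX ZX *v b) + Q *v (diag_on (range Inr) (case_sum (\<lambda>_. 0) a) *v b) = b"
    by (simp add: matrix_vector_mult_add_rdistrib matrix_vector_mul_assoc)
  then show ?thesis
    unfolding cov_stack_ZW_Y normal[symmetric] by (simp add: eq_diff_eq)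
qed

lemma ols_limit_Inr:
  assumes "pos_def_mat (covmat M ZW ZW)"
    and "covmat M ZX ZX *v stack \<beta>Z \<beta>X = (\<chi> m. cov M (\<lambda>\<omega>. ZX \<omega> $ m) Y)"
  defines "Q \<equiv> matrix_inv (covmat M ZW ZW)"
  shows "(\<chi> j. (Q *v (\<chi> m. cov M (\<lambda>\<omega>. ZW \<omega> $ m) Y)) $ Inr j)
    = \<beta>X - ((\<chi> j j'. Q $ Inr j $ Inr j') ** (\<chi> j j'. if j = j' then a j else 0)) *v \<beta>X"
  using ols_limit_eq[OF assms(1,2)] unfolding Q_def[symmetric]
  by (simp add: vec_eq_iff diag_on_Inr_mult_stack matrix_vector_mult_stack_zero_Inr diag_mult_vec
      matrix_vector_mul_assoc[symmetric])

lemma attenuation_matrix_eq: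
  assumes pd: "pos_def_mat (covmat M ZW ZW)"
  shows "matrix_inv ((\<chi> j j'. if j = j' then a j else 0) + covmat M X X
      - transpose (covmat M Z W) ** matrix_inv (covmat M Z Z) ** covmat M Z W)
    = (\<chi> j j'. matrix_inv (covmat M ZW ZW) $ Inr j $ Inr j')"
proof -
  have "pos_def_mat (covmat M Z Z)"
    using pd unfolding covmat_stack by (rule pos_def_block_mat_upper)
  from matrix_inv_schur_complement[OF pos_def_mat_invertible[OF pd[unfolded covmat_stack]]
      pos_def_mat_invertible[OF this]]
  show ?thesis
    unfolding covmat_stack covmat_transpose[of M W Z] covmat_W_W by (simp add: add.commute)
qed

lemma ols_coefficients_plim:
  fixes Ys :: "nat \<Rightarrow> 'a \<Rightarrow> real" and Zs :: "nat \<Rightarrow> 'a \<Rightarrow> real^'p" and Xs Ws :: "nat \<Rightarrow> 'a \<Rightarrow> real^'d"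
  assumes moments: "\<forall>f\<in>coords. \<forall>g\<in>coords.
        conv_in_prob M
          (\<lambda>N \<omega>. (\<Sum>i<N. f (Ys i \<omega>, Zs i \<omega>, Xs i \<omega>, Ws i \<omega>) * g (Ys i \<omega>, Zs i \<omega>, Xs i \<omega>, Ws i \<omega>)) / real N)
          (\<integral>\<omega>. f (Y \<omega>, Z \<omega>, X \<omega>, W \<omega>) * g (Y \<omega>, Z \<omega>, X \<omega>, W \<omega>) \<partial>M)"
    and ols: "\<forall>N \<omega> a' bZ bW.
        (\<Sum>i<N. (Ys i \<omega> - ahat N \<omega> - Zs i \<omega> \<bullet> bZhat N \<omega> - Ws i \<omega> \<bullet> bXhat N \<omega>)\<^sup>2)
          \<le> (\<Sum>i<N. (Ys i \<omega> - a' - Zs i \<omega> \<bullet> bZ - Ws i \<omega> \<bullet> bW)\<^sup>2)"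
    and pd: "pos_def_mat (covmat M ZW ZW)"
  shows "conv_in_prob M (\<lambda>N \<omega>. stack (bZhat N \<omega>) (bXhat N \<omega>))
    (matrix_inv (covmat M ZW ZW) *v (\<chi> m. cov M (\<lambda>\<omega>. ZW \<omega> $ m) Y))"
proof (rule conv_in_prob_ols[where chat=ahat, OF _ pos_def_mat_invertible[OF pd]])
  have c1: "(\<lambda>_. 1) \<in> coords" and cy: "(\<lambda>(y, z, x, w). y) \<in> coords"
    by (simp_all add: coords_def)
  show "conv_in_prob M
      (\<lambda>N \<omega>. (covmat (uniform_count_measure {..<N}) (\<lambda>i. stack (Zs i \<omega>) (Ws i \<omega>)) (\<lambda>i. stack (Zs i \<omega>) (Ws i \<omega>)),
               \<chi> k. cov (uniform_count_measure {..<N}) (\<lambda>i. stack (Zs i \<omega>) (Ws i \<omega>) $ k) (\<lambda>i. Ys i \<omega>)))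
      (covmat M ZW ZW, \<chi> m. cov M (\<lambda>\<omega>. ZW \<omega> $ m) Y)"
    using conv_in_prob_sample_covmat[where F=coords and T="\<lambda>i \<omega>. (Ys i \<omega>, Zs i \<omega>, Xs i \<omega>, Ws i \<omega>)"
        and Tpop="\<lambda>\<omega>. (Y \<omega>, Z \<omega>, X \<omega>, W \<omega>)" and feat="\<lambda>m (y, z, x, w). stack z w $ m"
        and resp="\<lambda>(y, z, x, w). y", OF _ c1 stack_coord_in_coords cy] moments
    by simp
  show "(\<Sum>i<N. (Ys i \<omega> - ahat N \<omega> - stack (Zs i \<omega>) (Ws i \<omega>) \<bullet> stack (bZhat N \<omega>) (bXhat N \<omega>))\<^sup>2)
      \<le> (\<Sum>i<N. (Ys i \<omega> - c' - stack (Zs i \<omega>) (Ws i \<omega>) \<bullet> b')\<^sup>2)" for N \<omega> c' b'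
    using ols by (simp add: inner_stack_split diff_diff_eq add.assoc)
qed

end

theorem theorem1:
  fixes M :: "'s measure"
    and Y :: "'s \<Rightarrow> real" and Z :: "'s \<Rightarrow> real^'p::finite"
    and X :: "'s \<Rightarrow> real^'d::finite" and W :: "'s \<Rightarrow> real^'d"
    and Ys :: "nat \<Rightarrow> 's \<Rightarrow> real" and Zs :: "nat \<Rightarrow> 's \<Rightarrow> real^'p"
    and Xs :: "nat \<Rightarrow> 's \<Rightarrow> real^'d" and Ws :: "nat \<Rightarrow> 's \<Rightarrow> real^'d"
    and A :: "real^'p^'p" and B C :: "real^'d^'p" and D F G :: "real^'d^'d"
    and \<alpha> :: real and \<beta>Z :: "real^'p" and \<beta>X :: "real^'d"
    and ahat :: "nat \<Rightarrow> 's \<Rightarrow> real" and bZhat :: "nat \<Rightarrow> 's \<Rightarrow> real^'p"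
    and bXhat :: "nat \<Rightarrow> 's \<Rightarrow> real^'d"
    and a :: "'d \<Rightarrow> real"
  assumes prob: "prob_space M"
    \<comment> \<open>random variables with finite second moments\<close>
    and meas_pop: "(\<lambda>\<omega>. (Y \<omega>, Z \<omega>, X \<omega>, W \<omega>)) \<in> borel_measurable M"
    and sq_int: "\<forall>f\<in>coords. integrable M (\<lambda>\<omega>. (f (Y \<omega>, Z \<omega>, X \<omega>, W \<omega>))\<^sup>2)"
    \<comment> \<open>covariance blocks\<close>
    and A_def: "A = covmat M Z Z" and B_def: "B = covmat M Z X" and C_def: "C = covmat M Z W"
    and D_def: "D = covmat M X X" and F_def: "F = covmat M X W" and G_def: "G = covmat M W W"
    \<comment> \<open>population least-squares coefficients\<close>
    and pop_ls: "\<forall>a' bZ bX. (\<integral>\<omega>. (1/2) * (Y \<omega> - \<alpha> - Z \<omega> \<bullet> \<beta>Z - X \<omega> \<bullet> \<beta>X)\<^sup>2 \<partial>M)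
                     \<le> (\<integral>\<omega>. (1/2) * (Y \<omega> - a' - Z \<omega> \<bullet> bZ - X \<omega> \<bullet> bX)\<^sup>2 \<partial>M)"
    \<comment> \<open>(i) identically distributed samples, sample moments converge in probability\<close>
    and meas_smp: "\<forall>i. (\<lambda>\<omega>. (Ys i \<omega>, Zs i \<omega>, Xs i \<omega>, Ws i \<omega>)) \<in> borel_measurable M"
    and ident: "\<forall>i. distr M borel (\<lambda>\<omega>. (Ys i \<omega>, Zs i \<omega>, Xs i \<omega>, Ws i \<omega>))
                  = distr M borel (\<lambda>\<omega>. (Y \<omega>, Z \<omega>, X \<omega>, W \<omega>))"
    and moments: "\<forall>f\<in>coords. \<forall>g\<in>coords.
        conv_in_prob M
          (\<lambda>N \<omega>. (\<Sum>i<N. f (Ys i \<omega>, Zs i \<omega>, Xs i \<omega>, Ws i \<omega>) * g (Ys i \<omega>, Zs i \<omega>, Xs i \<omega>, Ws i \<omega>)) / real N)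
          (\<integral>\<omega>. f (Y \<omega>, Z \<omega>, X \<omega>, W \<omega>) * g (Y \<omega>, Z \<omega>, X \<omega>, W \<omega>) \<partial>M)"
    \<comment> \<open>(ii) errors uncorrelated with measurement errors\<close>
    and uncorr: "\<forall>i j. cov M (\<lambda>\<omega>. Ys i \<omega> - \<alpha> - Zs i \<omega> \<bullet> \<beta>Z - Xs i \<omega> \<bullet> \<beta>X)
                          (\<lambda>\<omega>. (Ws i \<omega> - Xs i \<omega>) $ j) = 0"
    \<comment> \<open>(iii) positive definite covariance matrices of (Z,W) and (Z,X)\<close>
    and pd_ZW: "pos_def_mat (covmat M (\<lambda>\<omega>. stack (Z \<omega>) (W \<omega>)) (\<lambda>\<omega>. stack (Z \<omega>) (W \<omega>)))"
    and pd_ZX: "pos_def_mat (covmat M (\<lambda>\<omega>. stack (Z \<omega>) (X \<omega>)) (\<lambda>\<omega>. stack (Z \<omega>) (X \<omega>)))"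
    \<comment> \<open>OLS of Y_i on intercept, Z_i, W_i using the first N samples\<close>
    and ols: "\<forall>N \<omega> a' bZ bW.
        (\<Sum>i<N. (Ys i \<omega> - ahat N \<omega> - Zs i \<omega> \<bullet> bZhat N \<omega> - Ws i \<omega> \<bullet> bXhat N \<omega>)\<^sup>2)
          \<le> (\<Sum>i<N. (Ys i \<omega> - a' - Zs i \<omega> \<bullet> bZ - Ws i \<omega> \<bullet> bW)\<^sup>2)"
    \<comment> \<open>Pairwise partial PC+\<close>
    and ppc: "\<forall>j j'. j \<noteq> j' \<longrightarrow>
        partial_corr M (\<lambda>\<omega>. stack (Z \<omega>) (X \<omega>)) (Inr j) (Inr j') > 0"
    \<comment> \<open>CUME: W = X + E, E independent of (Z,X,Y), Cov(E) = diag(a)\<close>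
    and indepE: "prob_space.indep_set M
        (sets (vimage_algebra (space M) (\<lambda>\<omega>. W \<omega> - X \<omega>) borel))
        (sets (vimage_algebra (space M) (\<lambda>\<omega>. (Z \<omega>, X \<omega>, Y \<omega>)) borel))"
    and covE: "covmat M (\<lambda>\<omega>. W \<omega> - X \<omega>) (\<lambda>\<omega>. W \<omega> - X \<omega>) = (\<chi> j j'. if j = j' then a j else 0)"
    and a_nonneg: "\<forall>j. a j \<ge> 0"
  shows "let SigE = (\<chi> j j'. if j = j' then a j else 0) :: real^'d^'d;
             \<Omega> = matrix_inv (SigE + D - transpose C ** matrix_inv A ** C)
         in conv_in_prob M (\<lambda>N \<omega>. bXhat N \<omega> - \<beta>X) (- ((\<Omega> ** SigE) *v \<beta>X))
            \<and> (\<forall>j. \<Omega> $ j $ j > 0 \<and> (a j > 0 \<longrightarrow> \<Omega> $ j $ j \<le> 1 / a j))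
            \<and> (\<forall>j j'. j \<noteq> j' \<longrightarrow> \<Omega> $ j $ j' \<le> 0)"
proof -
  interpret cume_model M Y Z X W a
    using prob meas_pop sq_int indepE covE by (simp add: cume_model_def cume_model_axioms_def)
  define Q where "Q = matrix_inv (covmat M (\<lambda>\<omega>. stack (Z \<omega>) (W \<omega>)) (\<lambda>\<omega>. stack (Z \<omega>) (W \<omega>)))"
  define SigE :: "real^'d^'d" where "SigE = (\<chi> j j'. if j = j' then a j else 0)"
  define \<Omega> where "\<Omega> = (\<chi> j j'. Q $ Inr j $ Inr j')"
  have "matrix_inv (SigE + D - transpose C ** matrix_inv A ** C) = \<Omega>"
    unfolding SigE_def A_def C_def D_def \<Omega>_def Q_def by (rule attenuation_matrix_eq[OF pd_ZW])
  moreover have "conv_in_prob M (\<lambda>N \<omega>. bXhat N \<omega> - \<beta>X) (- ((\<Omega> ** SigE) *v \<beta>X))"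
    using conv_in_prob_diff_const[OF conv_in_prob_stack_Inr[OF ols_coefficients_plim[OF moments ols pd_ZW]],
        where c=\<beta>X]
    unfolding ols_limit_Inr[OF pd_ZW population_normal_equations[OF pop_ls]]
    by (simp add: Q_def SigE_def \<Omega>_def)
  moreover have "0 < \<Omega> $ j $ j" for j
    unfolding \<Omega>_def Q_def by (simp add: pos_def_matrix_inv_diag_pos[OF pd_ZW])
  moreover have "\<Omega> $ j $ j \<le> 1 / a j" if "0 < a j" for j
    unfolding \<Omega>_def Q_def using inverse_covmat_ZW_diag_le[OF pd_ZX a_nonneg that] by simp
  moreover have "\<Omega> $ j $ j' \<le> 0" if "j \<noteq> j'" for j j'
    using nonpos_offdiag_inverse_covmat_ZW[OF pd_ZX a_nonneg ppc] that
    unfolding \<Omega>_def Q_def nonpos_offdiag_on_def by simp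
  ultimately show ?thesis unfolding Let_def SigE_def by blast
qed

end
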